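(* Let $\rho\in(1/2,\infty)$, let $m$ be a positive integer with $m\le 2\rho$, and let $I_1,\dots,I_m$ be pairwise disjoint closed intervals in $[0,2\pi)$ (with the endpoints of $[0,2\pi)$ identified), each satisfying $\operatorname{meas}(I_i)\ge \pi/\rho$. Then there exists an entire function $f$ of order $\rho$ such that $$L(f)=\bigcup_{i=1}^{m}I_i.$$
   Context: For a transcendental entire $f$, the Fatou set $\mathcal{F}(f)$ is the set of points having a neighborhood in which the iterates $f^n$ ($n\ge 1$) form a normal family; the Julia set $\mathcal{J}(f)$ is its complement. A value $\theta\in[0,2\pi)$ is a Julia limiting direction of $f$ if there is an unbounded sequence $\{z_n\}\subset\mathcal{J}(f)$ with $\lim_{n\to\infty}\arg z_n=\theta$. $L(f)$ denotes the set of all Julia limiting directions of $f$. Throughout, the two endpoints of $[0,2\pi)$ are identified, so that $[0,2\pi)$ is a compact set (a circle), arguments are taken modulo $2\pi$, and $\operatorname{meas}$ is Lebesgue measure on it. With $T(r,f)$ the Nevanlinna characteristic and $\log^+x=\max\{\log x,0\}$, the order of $f$ is $\rho(f)=\limsup_{r\to\infty}\frac{\log^+T(r,f)}{\log r}$. *)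

theory Defs
  imports "HOL-Complex_Analysis.Complex_Analysis"
begin

section \<open>Fatou and Julia sets\<close>

text \<open>
  Normality of a family of holomorphic functions on a domain \<open>U\<close>, in the sense of the Riemann
  sphere: locally uniform convergence to \<open>\<infinity>\<close> along a subsequence is admitted. As \<open>U\<close> is
  connected, the spherical limit of holomorphic functions is either finite everywhere on \<open>U\<close> or
  identically \<open>\<infinity>\<close>.
\<close>

definition normal_family_on :: "complex set \<Rightarrow> (complex \<Rightarrow> complex) set \<Rightarrow> bool" where
  "normal_family_on U F \<longleftrightarrow>
     (\<forall>g :: nat \<Rightarrow> complex \<Rightarrow> complex. range g \<subseteq> F \<longrightarrow>
        (\<exists>r :: nat \<Rightarrow> nat. strict_mono r \<and>
           ((\<exists>h. \<forall>K. compact K \<and> K \<subseteq> U \<longrightarrow>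
                uniform_limit K (\<lambda>n. g (r n)) h sequentially) \<or>
            (\<forall>K. compact K \<and> K \<subseteq> U \<longrightarrow>
                (\<forall>B::real. \<forall>\<^sub>F n in sequentially. \<forall>z\<in>K. norm (g (r n) z) > B)))))"

definition fatou_set :: "(complex \<Rightarrow> complex) \<Rightarrow> complex set" where
  "fatou_set f =
     {z. \<exists>U. open U \<and> connected U \<and> z \<in> U \<and> normal_family_on U {f ^^ n |n. n \<ge> 1}}"

definition julia_set :: "(complex \<Rightarrow> complex) \<Rightarrow> complex set" where
  "julia_set f = - fatou_set f"


section \<open>Julia limiting directions\<close>

text \<open>
  Arguments are taken modulo \<open>2\<pi>\<close>, so \<open>arg z\<^sub>n \<rightarrow> \<theta>\<close> means that some choice \<open>\<phi> n\<close> of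
  arguments tends to \<open>\<theta>\<close> (for \<open>\<theta> = 0\<close> these may approach from below). Every real is an
  argument of \<open>0\<close>; this is harmless since an unbounded sequence has a subsequence
  tending to \<open>\<infinity>\<close>.
\<close>

definition julia_limiting_directions :: "(complex \<Rightarrow> complex) \<Rightarrow> real set" where
  "julia_limiting_directions f =
     {\<theta> \<in> {0..<2 * pi}. \<exists>z :: nat \<Rightarrow> complex. range z \<subseteq> julia_set f \<and> \<not> bounded (range z) \<and>
        (\<exists>\<phi> :: nat \<Rightarrow> real. (\<forall>n. is_Arg (z n) (\<phi> n)) \<and> \<phi> \<longlonglongrightarrow> \<theta>)}"

text \<open>
  Closed intervals of the circle \<open>[0, 2\<pi>)\<close> with identified endpoints: the images of the
  \<open>{a..b}\<close> modulo \<open>2\<pi>\<close>. They may contain \<open>0\<close> in their interior, and for \<open>b - a \<ge> 2\<pi>\<close>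
  one gets the whole circle.
\<close>

definition closed_circle_interval :: "real set \<Rightarrow> bool" where
  "closed_circle_interval S \<longleftrightarrow>
     (\<exists>a b. a \<le> b \<and> S = {\<theta> \<in> {0..<2 * pi}. \<exists>k::int. \<theta> + 2 * pi * of_int k \<in> {a..b}})"


section \<open>Nevanlinna characteristic and order\<close>

text \<open>Only used for \<open>x \<ge> 0\<close>; since \<open>ln 0 = 0\<close>, we have \<open>log_plus 0 = 0\<close> as usual.\<close>

definition log_plus :: "real \<Rightarrow> real" where
  "log_plus x = max (ln x) 0"

definition nevanlinna_proximity :: "(complex \<Rightarrow> complex) \<Rightarrow> real \<Rightarrow> real" where
  "nevanlinna_proximity f r =
     1 / (2 * pi) * (LBINT \<theta>:{0..2 * pi}. log_plus (norm (f (rcis r \<theta>))))"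

definition pole_count :: "(complex \<Rightarrow> complex) \<Rightarrow> real \<Rightarrow> real" where
  "pole_count f t = (\<Sum>z | norm z \<le> t \<and> is_pole f z. - real_of_int (zorder f z))"

definition nevanlinna_counting :: "(complex \<Rightarrow> complex) \<Rightarrow> real \<Rightarrow> real" where
  "nevanlinna_counting f r =
     (LBINT t:{0<..r}. (pole_count f t - pole_count f 0) / t) + pole_count f 0 * ln r"

definition nevanlinna_characteristic :: "(complex \<Rightarrow> complex) \<Rightarrow> real \<Rightarrow> real" where
  "nevanlinna_characteristic f r = nevanlinna_proximity f r + nevanlinna_counting f r"

definition growth_order :: "(complex \<Rightarrow> complex) \<Rightarrow> ereal" where
  "growth_order f =
     Limsup at_top (\<lambda>r::real. ereal (log_plus (nevanlinna_characteristic f r) / ln r))"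

end

theory Submission
  imports Defs "HOL-Real_Asymp.Real_Asymp"
begin

text \<open>
  Why the theorem holds. For every \<open>\<sigma> > 1/2\<close> there is an entire function \<open>E\<close> that differs from
  \<open>exp (z\<^sup>\<sigma>)\<close> by a bounded amount in the sector \<open>\<bar>arg z\<bar> \<le> \<pi>/(2\<sigma>)\<close> and is bounded in the rest of the
  plane (\<open>sector_exponential_exists\<close>; it is a multiple of a Mittag-Leffler function). The sector has
  opening \<open>\<pi>/\<sigma>\<close>, and this is where the lower bound \<open>\<pi>/\<rho>\<close> on the length of the intervals comes from.
  Each interval of the statement is covered by one rotated sector of order exactly \<open>\<rho>\<close> and one of
  order at most \<open>\<rho>\<close> (\<open>exponential_arc_system\<close>), and \<open>f\<close> is a small multiple of the sum of the
  corresponding rotated functions \<open>E\<close> (\<open>superposition_exists\<close>). As \<open>\<rho>\<close> is the largest order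
  involved, \<open>f\<close> has order \<open>\<rho>\<close>.

  Outside the intervals every summand is bounded. The factor is chosen so small that \<open>f\<close> maps the
  closed unit disc and all these directions into the disc of radius \<open>1/2\<close>. So the sectors over the
  complement of the intervals are attracted to the unit disc in one step, and Montel's theorem puts
  them into the Fatou set (\<open>fatou_set_if_trapped\<close>).

  Inside an interval, a dense set of directions is dominated by a single summand: where two sectors
  overlap, the one of larger order wins. In a dominated direction \<open>f\<close> is a perturbation of
  \<open>\<kappa> exp (z\<^sup>\<sigma>)\<close>. By Brouwer's theorem in the coordinate \<open>z\<^sup>\<sigma>\<close>, a sectorial box far out is mapped onto
  an entire annulus \<open>r' \<le> \<bar>w\<bar> \<le> 2r'\<close> that lies still further out
  (\<open>exponential_sector_covers_annuli\<close>). Two things follow. The annulus contains another such box,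
  so by iteration some point of the first box has an orbit that avoids the unit disc for ever. The
  annulus also meets an endpoint direction of an interval, where \<open>\<bar>f\<bar> \<le> 1/2\<close>, so another point of
  the box does enter the unit disc. Inside the Fatou set the basin of the unit disc is relatively
  closed (\<open>basin_closed_in_fatou_set\<close>); the box being connected, it must contain a point of the
  Julia set (\<open>connected_meets_julia_set\<close>).
\<close>

section \<open>Entire functions that are exponential in a single sector\<close>

lemma contour_integral_rectpath_sides:
  assumes cont: "continuous_on (path_image (rectpath (Complex x0 y0) (Complex x1 y1))) f"
    and le: "x0 \<le> x1" "y0 \<le> y1"
  shows "contour_integral (rectpath (Complex x0 y0) (Complex x1 y1)) f =
    contour_integral (linepath (Complex x0 y0) (Complex x1 y0)) f
    + contour_integral (linepath (Complex x1 y0) (Complex x1 y1)) f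
    - contour_integral (linepath (Complex x0 y1) (Complex x1 y1)) f
    - contour_integral (linepath (Complex x0 y0) (Complex x0 y1)) f"
proof -
  have c1: "continuous_on (closed_segment (Complex x0 y0) (Complex x1 y0)) f"
    and c2: "continuous_on (closed_segment (Complex x1 y0) (Complex x1 y1)) f"
    and c3: "continuous_on (closed_segment (Complex x1 y1) (Complex x0 y1)) f"
    and c4: "continuous_on (closed_segment (Complex x0 y1) (Complex x0 y0)) f"
    by (rule continuous_on_subset[OF cont], force simp: rectpath_def Let_def path_image_join)+
  have "contour_integral (rectpath (Complex x0 y0) (Complex x1 y1)) f =
    contour_integral (linepath (Complex x0 y0) (Complex x1 y0)) f
    + (contour_integral (linepath (Complex x1 y0) (Complex x1 y1)) f
    + (contour_integral (linepath (Complex x1 y1) (Complex x0 y1)) f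
    + contour_integral (linepath (Complex x0 y1) (Complex x0 y0)) f))"
    unfolding rectpath_def Let_def
    by (simp add: contour_integral_join contour_integrable_continuous_linepath c1 c2 c3 c4
        valid_path_join contour_integrable_joinI)
  then show ?thesis
    using contour_integral_reverse_linepath[OF c3] contour_integral_reverse_linepath[OF c4] by simp
qed

text \<open>
  In the coordinate \<open>\<zeta> = exp w\<close> the form \<open>exp (\<zeta>\<^sup>\<sigma>) d\<zeta> / (\<zeta> - z)\<close> becomes \<open>cauchy_kernel \<sigma> z w dw\<close>.
  The power is then single-valued, and circular arcs and rays become sides of rectangles.
\<close>

definition cauchy_kernel :: "real \<Rightarrow> complex \<Rightarrow> complex \<Rightarrow> complex" where
  "cauchy_kernel \<sigma> z w = exp (exp (of_real \<sigma> * w)) / (1 - z * exp (- w))"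

text \<open>
  This is the Cauchy integral of \<open>exp (\<zeta>\<^sup>\<sigma>)\<close> over the arc \<open>\<bar>\<zeta>\<bar> = exp X\<close>, \<open>\<bar>arg \<zeta>\<bar> \<le> \<beta>\<close>. The function with
  exponential growth in one sector is its limit as \<open>X\<close> tends to infinity.
\<close>

definition arc_transform :: "real \<Rightarrow> real \<Rightarrow> real \<Rightarrow> complex \<Rightarrow> complex" where
  "arc_transform \<sigma> \<beta> X z =
     contour_integral (linepath (Complex X (-\<beta>)) (Complex X \<beta>)) (cauchy_kernel \<sigma> z) / (2 * pi * \<i>)"

lemma continuous_on_cauchy_kernel:
  assumes "\<And>w. w \<in> S \<Longrightarrow> z \<noteq> exp w"
  shows "continuous_on S (cauchy_kernel \<sigma> z)"
  unfolding cauchy_kernel_def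
  by (intro continuous_intros) (use assms in \<open>auto simp: exp_minus field_simps\<close>)

lemma holomorphic_on_cauchy_kernel:
  assumes "\<And>w. w \<in> S \<Longrightarrow> z \<noteq> exp w"
  shows "cauchy_kernel \<sigma> z holomorphic_on S"
  unfolding cauchy_kernel_def
  by (intro holomorphic_intros) (use assms in \<open>auto simp: exp_minus field_simps\<close>)

lemma cauchy_kernel_rectangle_zero:
  assumes le: "x0 \<le> x1" "y0 \<le> y1" 
    and S: "open S" "convex S" "cbox (Complex x0 y0) (Complex x1 y1) \<subseteq> S"
    and no_pole: "\<And>w. w \<in> S \<Longrightarrow> z \<noteq> exp w"
  shows "contour_integral (linepath (Complex x0 y0) (Complex x1 y0)) (cauchy_kernel \<sigma> z)
    + contour_integral (linepath (Complex x1 y0) (Complex x1 y1)) (cauchy_kernel \<sigma> z)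
    - contour_integral (linepath (Complex x0 y1) (Complex x1 y1)) (cauchy_kernel \<sigma> z)
    - contour_integral (linepath (Complex x0 y0) (Complex x0 y1)) (cauchy_kernel \<sigma> z) = 0"
proof -
  have sub: "path_image (rectpath (Complex x0 y0) (Complex x1 y1)) \<subseteq> S"
    using path_image_rectpath_subset_cbox[of "Complex x0 y0" "Complex x1 y1"] le S(3) by simp
  have "(cauchy_kernel \<sigma> z has_contour_integral 0) (rectpath (Complex x0 y0) (Complex x1 y1))"
    by (rule Cauchy_theorem_convex_simple[OF holomorphic_on_cauchy_kernel[OF no_pole] S(2)])
       (use sub in auto)
  then have "contour_integral (rectpath (Complex x0 y0) (Complex x1 y1)) (cauchy_kernel \<sigma> z) = 0"
    by (rule contour_integral_unique)
  then show ?thesis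
    by (subst (asm) contour_integral_rectpath_sides)
       (use le sub no_pole in \<open>auto intro!: continuous_on_cauchy_kernel\<close>)
qed

text \<open>
  For \<open>\<bar>arg z\<bar> < \<beta>\<close> the strip \<open>\<bar>Im w\<bar> < \<pi>\<close> contains only one of the logarithms of \<open>z\<close>, hence only one pole.
  Its residue is the source of the term \<open>exp (z\<^sup>\<sigma>)\<close>.
\<close>

lemma cauchy_kernel_rectangle_residue:
  assumes \<beta>: "\<bar>\<phi>\<bar> < \<beta>" "\<beta> < pi" and s: "s > 0" "x0 < ln s" "ln s < x1"
    and z: "z = rcis s \<phi>"
  shows "contour_integral (linepath (Complex x0 (-\<beta>)) (Complex x1 (-\<beta>))) (cauchy_kernel \<sigma> z)
    + contour_integral (linepath (Complex x1 (-\<beta>)) (Complex x1 \<beta>)) (cauchy_kernel \<sigma> z)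
    - contour_integral (linepath (Complex x0 \<beta>) (Complex x1 \<beta>)) (cauchy_kernel \<sigma> z)
    - contour_integral (linepath (Complex x0 (-\<beta>)) (Complex x0 \<beta>)) (cauchy_kernel \<sigma> z)
    = 2 * pi * \<i> * exp (rcis (s powr \<sigma>) (\<sigma> * \<phi>))"
proof -
  define v where "v = Complex (ln s) \<phi>"
  define S where "S = {w::complex. \<bar>Im w\<bar> < pi}"
  define R where "R = rectpath (Complex x0 (-\<beta>)) (Complex x1 \<beta>)"
  have expv: "exp v = z"
    using s by (simp add: v_def z rcis_def exp_eq_polar)
  have S_eq: "S = {w. Im w < pi} \<inter> {w. Im w > -pi}" unfolding S_def by auto
  have oS: "open S" unfolding S_eq by (intro open_Int open_halfspace_Im_lt open_halfspace_Im_gt)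
  have cS: "convex S" unfolding S_eq by (intro convex_Int convex_halfspace_Im_lt convex_halfspace_Im_gt)
  have no_pole: "z \<noteq> exp w" if "w \<in> S - {v}" for w
  proof
    assume "z = exp w"
    then have "exp w = exp v" using expv by simp
    moreover have "\<bar>Im w - Im v\<bar> < 2 * pi" using that \<beta> by (auto simp: S_def v_def)
    ultimately have "w = v" using exp_complex_eqI by blast
    then show False using that by simp
  qed
  have vbox: "v \<in> box (Complex x0 (-\<beta>)) (Complex x1 \<beta>)"
    using \<beta> s by (auto simp: v_def in_box_complex_iff)
  have bS: "cbox (Complex x0 (-\<beta>)) (Complex x1 \<beta>) \<subseteq> S"
    using \<beta> by (auto simp: S_def in_cbox_complex_iff)
  have le: "x0 \<le> x1" "-\<beta> \<le> \<beta>" using \<beta> s by auto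
  have sub: "path_image R \<subseteq> S - {v}"
    using path_image_rectpath_cbox_minus_box[of "Complex x0 (-\<beta>)" "Complex x1 \<beta>"] le bS vbox
    by (auto simp: R_def)
  have "contour_integral R (cauchy_kernel \<sigma> z) =
      2 * pi * \<i> * (\<Sum>p\<in>{v}. winding_number R p * residue (cauchy_kernel \<sigma> z) p)"
  proof (rule Residue_theorem[OF oS convex_connected[OF cS]])
    show "cauchy_kernel \<sigma> z holomorphic_on S - {v}"
      by (rule holomorphic_on_cauchy_kernel[OF no_pole])
    show "\<forall>y. y \<notin> S \<longrightarrow> winding_number R y = 0"
      unfolding R_def using bS le by (auto intro!: winding_number_rectpath_outside)
  qed (use sub in \<open>auto simp: R_def\<close>)
  also have "\<dots> = 2 * pi * \<i> * (winding_number R v * residue (cauchy_kernel \<sigma> z) v)"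
    by simp
  also have "winding_number R v = 1"
    unfolding R_def using vbox by (rule winding_number_rectpath)
  also have "residue (cauchy_kernel \<sigma> z) v = exp (exp (of_real \<sigma> * v)) / 1"
    unfolding cauchy_kernel_def
  proof (rule residue_simple_pole_deriv[OF _ _ oS])
    show "((\<lambda>w. 1 - z * exp (- w)) has_field_derivative 1) (at v)"
      by (auto intro!: derivative_eq_intros simp: expv[symmetric] exp_minus)
    show "v \<in> S" using vbox bS box_subset_cbox by blast
  qed (auto intro!: holomorphic_intros simp: expv[symmetric] exp_minus convex_connected[OF cS])
  also have "exp (of_real \<sigma> * v) = rcis (s powr \<sigma>) (\<sigma> * \<phi>)"
    using s by (simp add: v_def exp_eq_polar rcis_def powr_def)
  finally have *: "contour_integral R (cauchy_kernel \<sigma> z) = 2 * pi * \<i> * exp (rcis (s powr \<sigma>) (\<sigma> * \<phi>))"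
    by simp
  show ?thesis
    using * unfolding R_def
    by (subst (asm) contour_integral_rectpath_sides)
       (use le sub no_pole in \<open>auto intro!: continuous_on_cauchy_kernel simp: R_def\<close>)
qed

lemma norm_cauchy_kernel:
  "norm (cauchy_kernel \<sigma> z (Complex t y)) =
     exp (exp (\<sigma> * t) * cos (\<sigma> * y)) / norm (1 - z * exp (- Complex t y))"
  by (simp add: cauchy_kernel_def norm_divide Re_exp)

lemma norm_one_minus_ge:
  assumes "norm z \<le> exp t / 2"
  shows "norm (1 - z * exp (- Complex t y)) \<ge> 1 / 2"
proof -
  have "norm (z * exp (- Complex t y)) \<le> 1 / 2"
    using assms by (simp add: norm_mult norm_divide exp_minus field_simps)
  then show ?thesis
    using norm_triangle_ineq2[of 1 "z * exp (- Complex t y)"] by simp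
qed

lemma horizontal_contour_integral_bound:
  assumes \<mu>: "\<mu> > 0" and le: "X \<le> Y" and M: "M \<ge> 0"
    and cont: "continuous_on (closed_segment (Complex X y) (Complex Y y)) f"
    and bound: "\<And>t. X \<le> t \<Longrightarrow> t \<le> Y \<Longrightarrow> norm (f (Complex t y)) \<le> M * exp (- \<mu> * t)"
  shows "norm (contour_integral (linepath (Complex X y) (Complex Y y)) f) \<le> M / \<mu> * exp (- \<mu> * X)"
proof -
  define I where "I = contour_integral (linepath (Complex X y) (Complex Y y)) f"
  define h where "h = (\<lambda>u::real. X + (Y - X) * u)"
  have lin: "linepath (Complex X y) (Complex Y y) u = Complex (h u) y" for u
    by (simp add: linepath_def h_def complex_eq_iff algebra_simps)
  have dd: "Complex Y y - Complex X y = of_real (Y - X)" by (simp add: complex_eq_iff)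
  have "(f has_contour_integral I) (linepath (Complex X y) (Complex Y y))"
    unfolding I_def
    by (rule has_contour_integral_integral[OF contour_integrable_continuous_linepath[OF cont]])
  then have I: "((\<lambda>u. f (Complex (h u) y) * of_real (Y - X)) has_integral I) {0..1}"
    unfolding has_contour_integral_linepath lin dd .
  have J: "((\<lambda>u. M * exp (- \<mu> * h u) * (Y - X)) has_integral
      (- (M / \<mu>) * exp (- \<mu> * h 1) - (- (M / \<mu>) * exp (- \<mu> * h 0)))) {0..1}"
    by (rule fundamental_theorem_of_calculus)
       (use \<mu> in \<open>auto intro!: derivative_eq_intros
         simp: h_def has_real_derivative_iff_has_vector_derivative[symmetric]\<close>)
  have "norm I \<le> - (M / \<mu>) * exp (- \<mu> * h 1) - (- (M / \<mu>) * exp (- \<mu> * h 0))"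
  proof -
    have "norm (f (Complex (h u) y) * of_real (Y - X)) \<le> M * exp (- \<mu> * h u) * (Y - X)"
      if "u \<in> {0..1}" for u
    proof -
      have "(Y - X) * u \<le> (Y - X) * 1" "0 \<le> (Y - X) * u"
        using that le mult_left_mono[of u 1 "Y - X"] by auto
      then have "X \<le> h u" "h u \<le> Y" by (auto simp: h_def)
      then have "norm (f (Complex (h u) y)) * \<bar>Y - X\<bar> \<le> M * exp (- \<mu> * h u) * \<bar>Y - X\<bar>"
        by (intro mult_right_mono bound) auto
      then show ?thesis using le by (simp add: norm_mult del: of_real_diff)
    qed
    then show ?thesis
      using integral_norm_bound_integral[OF has_integral_integrable[OF I] has_integral_integrable[OF J]]
        integral_unique[OF I] integral_unique[OF J] by metis
  qed
  also have "\<dots> \<le> M / \<mu> * exp (- \<mu> * X)" using M \<mu> by (simp add: h_def)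
  finally show ?thesis unfolding I_def .
qed

text \<open>
  On the horizontal sides the kernel decays doubly exponentially; a simple exponential is all that
  is needed of it.
\<close>

lemma double_exp_decay:
  fixes c \<sigma> t :: real
  assumes "c > 0"
  shows "exp (- c * exp (\<sigma> * t)) \<le> exp (- (c * \<sigma>) * t)"
proof -
  have "\<sigma> * t \<le> exp (\<sigma> * t)" using exp_ge_add_one_self[of "\<sigma> * t"] by linarith
  then have "c * (\<sigma> * t) \<le> c * exp (\<sigma> * t)" using assms by simp
  then show ?thesis by (simp add: algebra_simps)
qed

lemma cauchy_kernel_horizontal_bound:
  assumes c: "cos (\<sigma> * y) \<le> - c" "c > 0" and \<sigma>: "\<sigma> > 0" and le: "X \<le> Y"
    and \<delta>: "\<delta> > 0"
    and den: "\<And>t. X \<le> t \<Longrightarrow> t \<le> Y \<Longrightarrow> norm (1 - z * exp (- Complex t y)) \<ge> \<delta>"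
  shows "norm (contour_integral (linepath (Complex X y) (Complex Y y)) (cauchy_kernel \<sigma> z))
           \<le> 1 / (\<delta> * (c * \<sigma>)) * exp (- (c * \<sigma>) * X)"
proof -
  have "norm (contour_integral (linepath (Complex X y) (Complex Y y)) (cauchy_kernel \<sigma> z))
           \<le> (1 / \<delta>) / (c * \<sigma>) * exp (- (c * \<sigma>) * X)"
  proof (rule horizontal_contour_integral_bound)
    show "continuous_on (closed_segment (Complex X y) (Complex Y y)) (cauchy_kernel \<sigma> z)"
    proof (rule continuous_on_cauchy_kernel)
      fix w assume "w \<in> closed_segment (Complex X y) (Complex Y y)"
      then have w: "w = Complex (Re w) y" "X \<le> Re w" "Re w \<le> Y"
        using le by (auto simp: closed_segment_same_Im closed_segment_eq_real_ivl complex_eq_iff)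
      show "z \<noteq> exp w"
        using den[of "Re w"] w \<delta> by (auto simp: exp_minus)
    qed
    fix t assume t: "X \<le> t" "t \<le> Y"
    have "exp (\<sigma> * t) * cos (\<sigma> * y) \<le> exp (\<sigma> * t) * (- c)"
      using c by (intro mult_left_mono) auto
    then have "exp (exp (\<sigma> * t) * cos (\<sigma> * y)) \<le> exp (- c * exp (\<sigma> * t))"
      by (simp add: mult.commute)
    also have "\<dots> \<le> exp (- (c * \<sigma>) * t)" by (rule double_exp_decay[OF c(2)])
    finally have "norm (cauchy_kernel \<sigma> z (Complex t y)) \<le> exp (- (c * \<sigma>) * t) / \<delta>"
      unfolding norm_cauchy_kernel using den[OF t] \<delta> by (intro frac_le) auto
    then show "norm (cauchy_kernel \<sigma> z (Complex t y)) \<le> 1 / \<delta> * exp (- (c * \<sigma>) * t)" by simp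
  qed (use c \<sigma> le \<delta> in auto)
  then show ?thesis by simp
qed

lemma arc_transform_holomorphic:
  assumes "\<beta> > 0"
  shows "arc_transform \<sigma> \<beta> X holomorphic_on ball 0 (exp X)"
proof -
  have np: "1 - z * exp (- Complex X t) \<noteq> 0" if "z \<in> ball 0 (exp X)" for z t
  proof
    assume "1 - z * exp (- Complex X t) = 0"
    then have "norm (z * exp (- Complex X t)) = 1" by (metis eq_iff_diff_eq_0 norm_one)
    then show False using that by (simp add: norm_mult norm_divide exp_minus field_simps)
  qed
  define F where "F = (\<lambda>z t. cauchy_kernel \<sigma> z (Complex X t))"
  have cC: "continuous_on A (\<lambda>x. Complex X (h x))" if "continuous_on A h" for h :: "'a::topological_space \<Rightarrow> real" and A
    using that by (auto simp: Complex_eq intro!: continuous_intros)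
  have eq: "arc_transform \<sigma> \<beta> X z = integral (cbox (-\<beta>) \<beta>) (F z) / (2 * pi)" if z: "z \<in> ball 0 (exp X)" for z
  proof -
    have "cauchy_kernel \<sigma> z contour_integrable_on linepath (Complex X (-\<beta>)) (Complex X \<beta>)"
      by (intro contour_integrable_continuous_linepath continuous_on_cauchy_kernel)
         (use z in \<open>auto simp: closed_segment_same_Re\<close>)
    then have "(cauchy_kernel \<sigma> z has_contour_integral (2 * pi * \<i> * arc_transform \<sigma> \<beta> X z)) (linepath (Complex X (-\<beta>)) (Complex X \<beta>))"
      by (simp add: arc_transform_def has_contour_integral_integral)
    then have "((\<lambda>t. F z t) has_integral (- \<i> * (2 * pi * \<i> * arc_transform \<sigma> \<beta> X z))) {-\<beta>..\<beta>}"
      unfolding F_def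
      by (subst (asm) has_contour_integral_linepath_same_Re_iff[of _ X _ "-\<beta>" \<beta>]) (use assms in auto)
    then show ?thesis by (simp add: integral_unique)
  qed
  have cF: "continuous_on (cbox (-\<beta>) \<beta>) (F z)" if "z \<in> ball 0 (exp X)" for z
    unfolding F_def cauchy_kernel_def
    by (intro continuous_intros cC) (use np[OF that] in auto)
  have "(\<lambda>z. integral (cbox (-\<beta>) \<beta>) (F z)) holomorphic_on ball 0 (exp X)"
  proof (rule leibniz_rule_holomorphic)
    fix z :: complex and t assume z: "z \<in> ball 0 (exp X)"
    show "((\<lambda>z. F z t) has_field_derivative
       (exp (exp (of_real \<sigma> * Complex X t)) * exp (- Complex X t) / (1 - z * exp (- Complex X t))\<^sup>2)) (at z within ball 0 (exp X))"
      unfolding F_def cauchy_kernel_def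
      by (rule derivative_eq_intros refl | use np[OF z] in \<open>simp add: power2_eq_square\<close>)+
  next
    show "continuous_on (ball 0 (exp X) \<times> cbox (-\<beta>) \<beta>) (\<lambda>(z, t).
       exp (exp (of_real \<sigma> * Complex X t)) * exp (- Complex X t) / (1 - z * exp (- Complex X t))\<^sup>2)"
      unfolding case_prod_beta
      by (intro continuous_intros cC) (use np in \<open>auto simp: mem_Times_iff\<close>)
  next
    show "F z integrable_on cbox (-\<beta>) \<beta>" if "z \<in> ball 0 (exp X)" for z
      using cF[OF that] by (rule integrable_continuous)
  qed simp
  then have "(\<lambda>z. integral (cbox (-\<beta>) \<beta>) (F z) / (2 * pi)) holomorphic_on ball 0 (exp X)"
    by (intro holomorphic_intros) auto
  then show ?thesis
    by (rule holomorphic_transform) (simp add: eq)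
qed

text \<open>
  Moving the arc from \<open>X\<close> to \<open>Y\<close> costs two horizontal integrals, on which \<open>exp (\<zeta>\<^sup>\<sigma>)\<close> is tiny because
  \<open>cos (\<sigma>\<beta>) < 0\<close>. Hence the arc transforms form a Cauchy sequence, locally uniformly in \<open>z\<close>.
\<close>

lemma arc_transform_shift_bound:
  assumes c: "cos (\<sigma> * \<beta>) \<le> - c" "c > 0" and \<sigma>: "\<sigma> > 0" and \<beta>: "\<beta> > 0" and le: "X \<le> Y"
    and z: "norm z \<le> exp X / 2"
  shows "norm (arc_transform \<sigma> \<beta> Y z - arc_transform \<sigma> \<beta> X z) \<le> 1 / (c * \<sigma>) * exp (- (c * \<sigma>) * X)"
proof -
  let ?H = "\<lambda>y. contour_integral (linepath (Complex X y) (Complex Y y)) (cauchy_kernel \<sigma> z)"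
  let ?V = "\<lambda>x. contour_integral (linepath (Complex x (-\<beta>)) (Complex x \<beta>)) (cauchy_kernel \<sigma> z)"
  let ?B = "1 / (1/2 * (c * \<sigma>)) * exp (- (c * \<sigma>) * X)"
  have H: "norm (?H y) \<le> ?B" if "cos (\<sigma> * y) \<le> - c" for y
  proof (rule cauchy_kernel_horizontal_bound[OF that c(2) \<sigma> le])
    fix t assume "X \<le> t"
    then have "norm z \<le> exp t / 2" using z by (smt (verit) exp_le_cancel_iff divide_right_mono)
    then show "norm (1 - z * exp (- Complex t y)) \<ge> 1 / 2" by (rule norm_one_minus_ge)
  qed simp
  define S where "S = {w. norm z < exp (Re w)}"
  have S_eq: "S = {w. Re w > ln (norm z)}" if "z \<noteq> 0"
    unfolding S_def using that by (metis exp_less_cancel_iff exp_ln zero_less_norm_iff)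
  have S: "open S \<and> convex S"
    by (cases "z = 0") (simp_all add: S_eq open_halfspace_Re_gt convex_halfspace_Re_gt, simp add: S_def)
  have "?H (-\<beta>) + ?V Y - ?H \<beta> - ?V X = 0"
  proof (rule cauchy_kernel_rectangle_zero[OF le _ conjunct1[OF S] conjunct2[OF S]])
    show "cbox (Complex X (- \<beta>)) (Complex Y \<beta>) \<subseteq> S"
    proof
      fix w assume "w \<in> cbox (Complex X (- \<beta>)) (Complex Y \<beta>)"
      then have "exp X \<le> exp (Re w)" by (simp add: in_cbox_complex_iff)
      then show "w \<in> S" using z exp_gt_zero[of X] unfolding S_def mem_Collect_eq by linarith
    qed
  qed (use \<beta> in \<open>auto simp: S_def\<close>)
  then have "?V Y - ?V X = ?H \<beta> - ?H (-\<beta>)" by (simp add: algebra_simps)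
  then have "norm (?V Y - ?V X) \<le> ?B + ?B"
  proof -
    have "norm (?H \<beta> - ?H (-\<beta>)) \<le> norm (?H \<beta>) + norm (?H (-\<beta>))" by (rule norm_triangle_ineq4)
    also have "\<dots> \<le> ?B + ?B" using H[of \<beta>] H[of "-\<beta>"] c by (intro add_mono) auto
    finally show ?thesis unfolding \<open>?V Y - ?V X = _\<close> .
  qed
  moreover have "arc_transform \<sigma> \<beta> Y z - arc_transform \<sigma> \<beta> X z = (?V Y - ?V X) / (2 * pi * \<i>)"
    by (simp add: arc_transform_def diff_divide_distrib)
  then have "norm (arc_transform \<sigma> \<beta> Y z - arc_transform \<sigma> \<beta> X z) = norm (?V Y - ?V X) / (2 * pi)"
    by (simp add: norm_divide norm_mult)
  ultimately have "norm (arc_transform \<sigma> \<beta> Y z - arc_transform \<sigma> \<beta> X z) \<le> (?B + ?B) / (2 * pi)"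
    by (metis divide_right_mono pi_ge_zero zero_le_mult_iff zero_le_numeral)
  also have "\<dots> = (2 / pi) * (1 / (c * \<sigma>) * exp (- (c * \<sigma>) * X))" by (simp add: field_simps)
  also have "\<dots> \<le> 1 * (1 / (c * \<sigma>) * exp (- (c * \<sigma>) * X))"
    using c \<sigma> pi_ge_two by (intro mult_right_mono) auto
  finally show ?thesis by simp
qed

lemma arc_transform_limit_exists:
  assumes c: "cos (\<sigma> * \<beta>) \<le> - c" "c > 0" and \<sigma>: "\<sigma> > 0" and \<beta>: "\<beta> > 0"
  obtains E where "E holomorphic_on UNIV"
    and "\<And>z. (\<lambda>n. arc_transform \<sigma> \<beta> (real n) z) \<longlonglongrightarrow> E z"
    and "\<And>z X. norm z \<le> exp X / 2 \<Longrightarrow> norm (E z - arc_transform \<sigma> \<beta> X z) \<le> 1 / (c * \<sigma>) * exp (- (c * \<sigma>) * X)"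
proof -
  define G where "G = (\<lambda>X. arc_transform \<sigma> \<beta> X)"
  define b where "b = (\<lambda>X. 1 / (c * \<sigma>) * exp (- (c * \<sigma>) * X))"
  have shift: "norm (G Y z - G X z) \<le> b X" if "X \<le> Y" "norm z \<le> exp X / 2" for X Y z
    unfolding G_def b_def by (rule arc_transform_shift_bound[OF c \<sigma> \<beta> that])
  have c\<sigma>: "c * \<sigma> > 0" using c \<sigma> by simp
  have b0: "(\<lambda>n. b (real n)) \<longlonglongrightarrow> 0"
  proof -
    have "(\<lambda>n. exp (- k * real n)) \<longlonglongrightarrow> 0" if "k > 0" for k :: real
      using that by real_asymp
    from tendsto_mult_right_zero[OF this[OF c\<sigma>]] show ?thesis unfolding b_def .
  qed
  have big: "\<forall>\<^sub>F n in sequentially. B \<le> exp (real n) / 2" for B :: real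
    by real_asymp
  have "Cauchy (\<lambda>n. G (real n) z)" for z
  proof (rule metric_CauchyI)
    fix e :: real assume "e > 0"
    then have "\<forall>\<^sub>F n in sequentially. b (real n) < e / 2"
      using order_tendstoD(2)[OF b0, of "e / 2"] by simp
    with big[of "norm z"] have "\<forall>\<^sub>F n in sequentially. norm z \<le> exp (real n) / 2 \<and> b (real n) < e / 2"
      by (rule eventually_conj)
    then obtain N where N: "norm z \<le> exp (real N) / 2" "b (real N) < e / 2"
      by (auto simp: eventually_sequentially)
    have near: "dist (G (real n) z) (G (real N) z) < e / 2" if "n \<ge> N" for n
      using shift[of "real N" "real n" z] that N by (simp add: dist_norm)
    show "\<exists>M. \<forall>m\<ge>M. \<forall>n\<ge>M. dist (G (real m) z) (G (real n) z) < e"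
      using near dist_triangle_half_l[of _ "G (real N) z" e] by (metis dist_commute)
  qed
  then have conv: "(\<lambda>n. G (real n) z) \<longlonglongrightarrow> lim (\<lambda>n. G (real n) z)" for z
    by (simp add: Cauchy_convergent_iff convergent_LIMSEQ_iff)
  define E where "E = (\<lambda>z. lim (\<lambda>n. G (real n) z))"
  have bound: "norm (E z - G X z) \<le> b X" if "norm z \<le> exp X / 2" for z X
  proof (rule tendsto_upperbound)
    show "(\<lambda>n. norm (G (real n) z - G X z)) \<longlonglongrightarrow> norm (E z - G X z)"
      unfolding E_def by (intro tendsto_intros conv)
    show "\<forall>\<^sub>F n in sequentially. norm (G (real n) z - G X z) \<le> b X"
      using eventually_ge_at_top[of "nat \<lceil>X\<rceil>"]
      by eventually_elim (rule shift[OF _ that], linarith)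
  qed simp
  have "E holomorphic_on UNIV"
  proof -
    have "E holomorphic_on ball 0 R" if R: "R > 0" for R
    proof -
      obtain N where N: "R \<le> exp (real N) / 2"
        using big[of R] by (auto simp: eventually_sequentially)
      have N': "R \<le> exp (real (n + N)) / 2" for n
        using N by (smt (verit) exp_le_cancel_iff divide_right_mono of_nat_add of_nat_0_le_iff)
      have ul: "uniform_limit (ball 0 R) (\<lambda>n. G (real (n + N))) E sequentially"
      proof (rule uniform_limitI)
        fix e :: real assume "e > 0"
        then have "\<forall>\<^sub>F n in sequentially. b (real (n + N)) < e"
          using order_tendstoD(2)[OF LIMSEQ_ignore_initial_segment[OF b0, of N]] by simp
        then show "\<forall>\<^sub>F n in sequentially. \<forall>z\<in>ball 0 R. dist (G (real (n + N)) z) (E z) < e"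
        proof eventually_elim
          case (elim n)
          show ?case
          proof
            fix z :: complex assume "z \<in> ball 0 R"
            then have "norm z \<le> exp (real (n + N)) / 2" using N'[of n] by simp
            from bound[OF this] elim show "dist (G (real (n + N)) z) (E z) < e"
              by (simp add: dist_norm norm_minus_commute)
          qed
        qed
      qed
      show ?thesis
      proof (rule holomorphic_uniform_sequence[OF open_ball])
        fix n
        have "ball 0 R \<subseteq> ball (0::complex) (exp (real (n + N)))"
          using N'[of n] exp_gt_zero[of "real (n + N)"] by (intro subset_ball) linarith
        then show "G (real (n + N)) holomorphic_on ball 0 R"
          unfolding G_def using arc_transform_holomorphic[OF \<beta>] holomorphic_on_subset by blast
      next
        fix x :: complex assume "x \<in> ball 0 R"
        then obtain d where "d > 0" "cball x d \<subseteq> ball 0 R"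
          using open_contains_cball_eq[OF open_ball] by blast
        then show "\<exists>d>0. cball x d \<subseteq> ball 0 R \<and>
            uniform_limit (cball x d) (\<lambda>n. G (real (n + N))) E sequentially"
          using uniform_limit_on_subset[OF ul] by blast
      qed
    qed
    then have "E field_differentiable at z" for z
      using holomorphic_on_imp_differentiable_at[OF _ open_ball, of E 0 "norm z + 1" z]
      by (simp add: add_nonneg_pos)
    then show ?thesis by (simp add: holomorphic_on_def field_differentiable_at_within)
  qed
  then show ?thesis
    using conv bound that[of E] unfolding E_def G_def b_def by blast
qed

text \<open>
  The distance of \<open>1\<close> from a ray that makes an angle of at least \<open>d\<close> with the positive axis.
\<close>

lemma norm_one_minus_rcis_ge:
  assumes "cos \<psi> \<le> cos d" "r \<ge> 0" "0 \<le> d" "d \<le> pi"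
  shows "norm (1 - rcis r \<psi>) \<ge> sin d"
proof (rule power2_le_imp_le)
  have "(sin d)\<^sup>2 \<le> (r - cos d)\<^sup>2 + (sin d)\<^sup>2" by simp
  also have "\<dots> = 1 - 2 * r * cos d + r\<^sup>2"
    using sin_cos_squared_add[of d] by (simp add: power2_eq_square algebra_simps)
  also have "\<dots> \<le> 1 - 2 * r * cos \<psi> + r\<^sup>2"
    using mult_left_mono[OF assms(1), of "2 * r"] assms(2) by simp
  also have "\<dots> = (1 - r * cos \<psi>)\<^sup>2 + (r * sin \<psi>)\<^sup>2"
    using sin_cos_squared_add[of \<psi>] by algebra
  also have "\<dots> = (norm (1 - rcis r \<psi>))\<^sup>2"
    by (simp add: cmod_power2 Re_rcis Im_rcis)
  finally show "(sin d)\<^sup>2 \<le> (norm (1 - rcis r \<psi>))\<^sup>2" .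
qed simp

lemma cos_le_cos_far:
  assumes "0 \<le> d" "d \<le> \<bar>\<psi>\<bar>" "\<bar>\<psi>\<bar> \<le> 2 * pi - d"
  shows "cos \<psi> \<le> cos d"
proof (cases "\<bar>\<psi>\<bar> \<le> pi")
  case True
  then have "cos \<bar>\<psi>\<bar> \<le> cos d" using assms by (intro cos_monotone_0_pi_le) auto
  then show ?thesis by simp
next
  case False
  then have "cos (2 * pi - \<bar>\<psi>\<bar>) \<le> cos d" using assms by (intro cos_monotone_0_pi_le) auto
  then show ?thesis by (simp add: cos_diff)
qed

text \<open>
  Shrinking the arc from radius \<open>exp X\<close> to radius \<open>1\<close> crosses the pole exactly when \<open>\<bar>arg z\<bar> < \<beta>\<close>. What
  remains is an integral over the unit arc, far from \<open>z\<close>, and integrals over the rays at the angles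
  \<open>\<plusminus>\<beta>\<close>; the latter are under control as long as \<open>arg z\<close> stays away from \<open>\<plusminus>\<beta>\<close>.
\<close>

lemma arc_transform_estimate:
  assumes c: "cos (\<sigma> * \<beta>) \<le> - c" "c > 0" and \<sigma>: "\<sigma> > 0"
    and d: "0 < d" "d < pi" and \<beta>: "0 < \<beta>" "\<beta> \<le> pi - d"
    and s: "s \<ge> 2" "2 * s \<le> exp X" and \<phi>: "\<bar>\<phi>\<bar> \<le> pi"
  defines "C \<equiv> exp 1 + 1 / (sin d * (c * \<sigma>))"
  shows "\<bar>\<phi>\<bar> \<le> \<beta> - d \<Longrightarrow>
           norm (arc_transform \<sigma> \<beta> X (rcis s \<phi>) - exp (rcis (s powr \<sigma>) (\<sigma> * \<phi>))) \<le> C"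
    and "\<bar>\<phi>\<bar> \<ge> \<beta> + d \<Longrightarrow> norm (arc_transform \<sigma> \<beta> X (rcis s \<phi>)) \<le> C"
proof -
  define z where "z = rcis s \<phi>"
  let ?H = "\<lambda>y. contour_integral (linepath (Complex 0 y) (Complex X y)) (cauchy_kernel \<sigma> z)"
  let ?V = "\<lambda>x. contour_integral (linepath (Complex x (-\<beta>)) (Complex x \<beta>)) (cauchy_kernel \<sigma> z)"
  define A where "A = 1 / (sin d * (c * \<sigma>))"
  have sd: "sin d > 0" using d by (intro sin_gt_zero) auto
  have A0: "A \<ge> 0" unfolding A_def using sd c \<sigma> by simp
  have X: "0 < ln s" "ln s < X" "0 \<le> X"
  proof -
    show 1: "0 < ln s" using s by simp
    have "exp (ln s) < exp X" using s by simp
    then show 2: "ln s < X" by (simp only: exp_less_cancel_iff)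
    show "0 \<le> X" using 1 2 by simp
  qed
  have nz: "norm z = s" using s by (simp add: z_def)
  have arc0: "norm (?V 0) \<le> 2 * pi * exp 1"
  proof -
    have "norm (?V 0) \<le> exp 1 * norm (Complex 0 \<beta> - Complex 0 (-\<beta>))"
    proof (rule contour_integral_bound_linepath)
      show "cauchy_kernel \<sigma> z contour_integrable_on linepath (Complex 0 (- \<beta>)) (Complex 0 \<beta>)"
        by (intro contour_integrable_continuous_linepath continuous_on_cauchy_kernel)
           (use nz s in \<open>auto simp: closed_segment_same_Re\<close>)
      fix w assume "w \<in> closed_segment (Complex 0 (- \<beta>)) (Complex 0 \<beta>)"
      then have w: "w = Complex 0 (Im w)" by (auto simp: closed_segment_same_Re complex_eq_iff)
      have "1 \<le> norm (z * exp (- Complex 0 (Im w))) - norm (1::complex)"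
        using nz s by (simp add: norm_mult norm_exp_eq_Re)
      also have "\<dots> \<le> norm (1 - z * exp (- Complex 0 (Im w)))"
        by (metis norm_minus_commute norm_triangle_ineq2)
      finally have "exp (exp (\<sigma> * 0) * cos (\<sigma> * Im w)) / norm (1 - z * exp (- Complex 0 (Im w))) \<le> exp 1 / 1"
        by (intro frac_le) auto
      then show "norm (cauchy_kernel \<sigma> z w) \<le> exp 1"
        by (subst w) (simp only: norm_cauchy_kernel div_by_1)
    qed simp
    also have "norm (Complex 0 \<beta> - Complex 0 (-\<beta>)) = 2 * \<beta>" 
      using \<beta> by (simp add: cmod_def real_sqrt_mult)
    also have "exp 1 * (2 * \<beta>) \<le> exp 1 * (2 * pi)" using \<beta> d by simp
    finally show ?thesis by (simp add: mult_ac)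
  qed
  have H: "norm (?H y) \<le> A" if y: "y = \<beta> \<or> y = - \<beta>" and far: "d \<le> \<bar>\<phi> - y\<bar>" "\<bar>\<phi> - y\<bar> \<le> 2 * pi - d" for y
  proof -
    have "norm (?H y) \<le> 1 / (sin d * (c * \<sigma>)) * exp (- (c * \<sigma>) * 0)"
    proof (rule cauchy_kernel_horizontal_bound[OF _ c(2) \<sigma> X(3) sd])
      show "cos (\<sigma> * y) \<le> - c" using c y by auto
      fix t
      have "z * exp (- Complex t y) = rcis (s * exp (- t)) (\<phi> - y)"
      proof -
        have "exp (- Complex t y) = rcis (exp (- t)) (- y)" by (simp add: rcis_def exp_eq_polar)
        then show ?thesis by (simp add: z_def rcis_mult)
      qed
      then show "sin d \<le> norm (1 - z * exp (- Complex t y))"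
        using norm_one_minus_rcis_ge[OF cos_le_cos_far[OF _ far]] d s by simp
    qed
    then show ?thesis unfolding A_def by simp
  qed
  have comb: "norm ((v0 + hb - ha) / (2 * pi * \<i>)) \<le> C"
    if "norm v0 \<le> 2 * pi * exp 1" "norm hb \<le> A" "norm ha \<le> A" for v0 ha hb :: complex
  proof -
    have "norm (v0 + hb - ha) \<le> 2 * pi * exp 1 + A + A"
      using that by (smt (verit) norm_triangle_ineq norm_triangle_ineq4)
    also have "\<dots> \<le> 2 * pi * exp 1 + 2 * pi * A"
      using mult_right_mono[of 1 pi A] A0 pi_ge_two by simp
    finally have "norm (v0 + hb - ha) / (2 * pi) \<le> (2 * pi * (exp 1 + A)) / (2 * pi)"
      by (intro divide_right_mono) (auto simp: algebra_simps)
    then show ?thesis by (simp add: norm_divide norm_mult C_def A_def)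
  qed
  show "norm (arc_transform \<sigma> \<beta> X (rcis s \<phi>) - exp (rcis (s powr \<sigma>) (\<sigma> * \<phi>))) \<le> C" if "\<bar>\<phi>\<bar> \<le> \<beta> - d"
  proof -
    have "?H (-\<beta>) + ?V X - ?H \<beta> - ?V 0 = 2 * pi * \<i> * exp (rcis (s powr \<sigma>) (\<sigma> * \<phi>))"
      by (rule cauchy_kernel_rectangle_residue[OF _ _ _ X(1,2) z_def]) (use that d \<beta> s in auto)
    then have "arc_transform \<sigma> \<beta> X z - exp (rcis (s powr \<sigma>) (\<sigma> * \<phi>)) = (?V 0 + ?H \<beta> - ?H (-\<beta>)) / (2 * pi * \<i>)"
      by (simp add: arc_transform_def field_simps)
    moreover have "d \<le> \<bar>\<phi> - \<beta>\<bar>" "\<bar>\<phi> - \<beta>\<bar> \<le> 2 * pi - d"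
      "d \<le> \<bar>\<phi> - (-\<beta>)\<bar>" "\<bar>\<phi> - (-\<beta>)\<bar> \<le> 2 * pi - d"
      using that d \<beta> by linarith+
    then have "norm (?H \<beta>) \<le> A" "norm (?H (-\<beta>)) \<le> A"
      using H[of \<beta>] H[of "-\<beta>"] by blast+
    ultimately show ?thesis using comb arc0 by (simp add: z_def)
  qed
  show "norm (arc_transform \<sigma> \<beta> X (rcis s \<phi>)) \<le> C" if "\<bar>\<phi>\<bar> \<ge> \<beta> + d"
  proof -
    define S where "S = {w::complex. \<bar>Im w\<bar> < \<bar>\<phi>\<bar>}"
    have S_eq: "S = {w. Im w < \<bar>\<phi>\<bar>} \<inter> {w. Im w > -\<bar>\<phi>\<bar>}" unfolding S_def by auto
    have oS: "open S" unfolding S_eq by (intro open_Int open_halfspace_Im_lt open_halfspace_Im_gt)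
    have cS: "convex S" unfolding S_eq by (intro convex_Int convex_halfspace_Im_lt convex_halfspace_Im_gt)
    have "?H (-\<beta>) + ?V X - ?H \<beta> - ?V 0 = 0"
    proof (rule cauchy_kernel_rectangle_zero[OF X(3) _ oS cS])
      show "cbox (Complex 0 (- \<beta>)) (Complex X \<beta>) \<subseteq> S"
        using that d by (auto simp: S_def in_cbox_complex_iff)
      fix w assume w: "w \<in> S"
      show "z \<noteq> exp w"
      proof
        assume "z = exp w"
        then have "exp w = exp (Complex (ln s) \<phi>)" using s by (simp add: z_def rcis_def exp_eq_polar)
        moreover have "\<bar>Im w - \<phi>\<bar> < 2 * pi" using w \<phi> by (auto simp: S_def)
        ultimately have "w = Complex (ln s) \<phi>" using exp_complex_eqI[of w "Complex (ln s) \<phi>"] by simp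
        then have "Im w = \<phi>" by simp
        then show False using w by (simp add: S_def)
      qed
    qed (use \<beta> in auto)
    then have "?V X = ?V 0 + ?H \<beta> - ?H (-\<beta>)" by (simp add: algebra_simps)
    then have "arc_transform \<sigma> \<beta> X z = (?V 0 + ?H \<beta> - ?H (-\<beta>)) / (2 * pi * \<i>)"
      by (simp add: arc_transform_def)
    moreover have "d \<le> \<bar>\<phi> - \<beta>\<bar>" "\<bar>\<phi> - \<beta>\<bar> \<le> 2 * pi - d"
      "d \<le> \<bar>\<phi> - (-\<beta>)\<bar>" "\<bar>\<phi> - (-\<beta>)\<bar> \<le> 2 * pi - d"
      using that d \<beta> \<phi> by linarith+
    then have "norm (?H \<beta>) \<le> A" "norm (?H (-\<beta>)) \<le> A"
      using H[of \<beta>] H[of "-\<beta>"] by blast+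
    ultimately show ?thesis using comb arc0 by (simp add: z_def)
  qed
qed

text \<open>
  Widening the arc changes nothing in the limit, since \<open>exp (\<zeta>\<^sup>\<sigma>)\<close> tends to zero on the added pieces. So
  two different values of \<open>\<beta>\<close> describe the same entire function, and the estimate near the ray of
  the one angle is supplied by the other.
\<close>

lemma arc_transform_angle_independent:
  assumes c: "c > 0" and \<sigma>: "\<sigma> > 0" and \<beta>: "0 < \<beta>" "\<beta> \<le> \<gamma>" "\<gamma> \<le> pi"
    and neg: "\<And>y. \<beta> \<le> y \<Longrightarrow> y \<le> \<gamma> \<Longrightarrow> cos (\<sigma> * y) \<le> - c"
  shows "(\<lambda>n. arc_transform \<sigma> \<gamma> (real n) z - arc_transform \<sigma> \<beta> (real n) z) \<longlonglongrightarrow> 0"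
proof (rule Lim_null_comparison)
  let ?V = "\<lambda>x a b. contour_integral (linepath (Complex x a) (Complex x b)) (cauchy_kernel \<sigma> z)"
  have "\<forall>\<^sub>F n in sequentially. norm z \<le> exp (real n) / 2" by real_asymp
  then show "\<forall>\<^sub>F n in sequentially. norm (arc_transform \<sigma> \<gamma> (real n) z - arc_transform \<sigma> \<beta> (real n) z)
      \<le> 2 * exp (- (c * \<sigma>) * real n)"
  proof eventually_elim
    case (elim n)
    let ?x = "real n"
    have cont: "continuous_on (closed_segment (Complex ?x a) (Complex ?x b)) (cauchy_kernel \<sigma> z)" for a b
    proof (rule continuous_on_cauchy_kernel)
      fix w assume "w \<in> closed_segment (Complex ?x a) (Complex ?x b)"
      then have "norm (exp w) = exp ?x" by (auto simp: closed_segment_same_Re)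
      then show "z \<noteq> exp w" using elim exp_gt_zero[of ?x] by auto
    qed
    have small: "norm (?V ?x a b) \<le> 2 * exp (- (c * \<sigma>) * ?x) * (b - a)"
      if ab: "a \<le> b" and neg': "\<And>y. a \<le> y \<Longrightarrow> y \<le> b \<Longrightarrow> cos (\<sigma> * y) \<le> - c" for a b
    proof -
      have "norm (?V ?x a b) \<le> 2 * exp (- (c * \<sigma>) * ?x) * norm (Complex ?x b - Complex ?x a)"
      proof (rule contour_integral_bound_linepath[OF contour_integrable_continuous_linepath[OF cont]])
        fix w assume "w \<in> closed_segment (Complex ?x a) (Complex ?x b)"
        then have "Re w = ?x" "a \<le> Im w" "Im w \<le> b"
          using ab by (simp_all add: closed_segment_same_Re closed_segment_eq_real_ivl)
        then obtain y where w: "w = Complex ?x y" "a \<le> y" "y \<le> b"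
          using complex.collapse[of w] by metis
        have "exp (\<sigma> * ?x) * cos (\<sigma> * y) \<le> exp (\<sigma> * ?x) * (- c)"
          using neg'[OF w(2,3)] by (intro mult_left_mono) auto
        then have "exp (exp (\<sigma> * ?x) * cos (\<sigma> * y)) \<le> exp (- c * exp (\<sigma> * ?x))"
          by (simp add: mult.commute)
        also have "\<dots> \<le> exp (- (c * \<sigma>) * ?x)" by (rule double_exp_decay[OF c])
        finally have "norm (cauchy_kernel \<sigma> z w) \<le> exp (- (c * \<sigma>) * ?x) / (1 / 2)"
          unfolding norm_cauchy_kernel w using norm_one_minus_ge[OF elim, of y] by (intro frac_le) auto
        then show "norm (cauchy_kernel \<sigma> z w) \<le> 2 * exp (- (c * \<sigma>) * ?x)" by simp
      qed simp
      also have "norm (Complex ?x b - Complex ?x a) = b - a" using ab by (simp add: cmod_def)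
      finally show ?thesis .
    qed
    have "?V ?x (-\<gamma>) \<gamma> = ?V ?x (-\<gamma>) (-\<beta>) + ?V ?x (-\<beta>) \<gamma>"
      by (rule contour_integral_split_linepath[OF cont])
         (use \<beta> in \<open>auto simp: closed_segment_same_Re closed_segment_eq_real_ivl\<close>)
    also have "?V ?x (-\<beta>) \<gamma> = ?V ?x (-\<beta>) \<beta> + ?V ?x \<beta> \<gamma>"
      by (rule contour_integral_split_linepath[OF cont])
         (use \<beta> in \<open>auto simp: closed_segment_same_Re closed_segment_eq_real_ivl\<close>)
    finally have "arc_transform \<sigma> \<gamma> ?x z - arc_transform \<sigma> \<beta> ?x z = (?V ?x (-\<gamma>) (-\<beta>) + ?V ?x \<beta> \<gamma>) / (2 * pi * \<i>)"
      by (simp add: arc_transform_def field_simps)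
    then have "norm (arc_transform \<sigma> \<gamma> ?x z - arc_transform \<sigma> \<beta> ?x z) \<le>
       norm (?V ?x (-\<gamma>) (-\<beta>) + ?V ?x \<beta> \<gamma>) / (2 * pi)" by (simp add: norm_divide norm_mult)
    also have "\<dots> \<le> (2 * exp (- (c * \<sigma>) * ?x) * (\<gamma> - \<beta>) + 2 * exp (- (c * \<sigma>) * ?x) * (\<gamma> - \<beta>)) / (2 * pi)"
    proof (intro divide_right_mono order_trans[OF norm_triangle_ineq] add_mono)
      show "norm (?V ?x (-\<gamma>) (-\<beta>)) \<le> 2 * exp (- (c * \<sigma>) * ?x) * (\<gamma> - \<beta>)"
        using small[of "-\<gamma>" "-\<beta>"] neg[of "- y" for y] \<beta> by force
      show "norm (?V ?x \<beta> \<gamma>) \<le> 2 * exp (- (c * \<sigma>) * ?x) * (\<gamma> - \<beta>)"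
        using small[of \<beta> \<gamma>] neg \<beta> by simp
    qed simp
    also have "\<dots> = 2 * exp (- (c * \<sigma>) * ?x) * ((\<gamma> - \<beta>) / pi)" by (simp add: field_simps)
    also have "\<dots> \<le> 2 * exp (- (c * \<sigma>) * ?x) * 1"
      using \<beta> by (intro mult_left_mono) (auto simp: field_simps)
    finally show ?case by simp
  qed
  have "(\<lambda>n. 2 * exp (- k * real n)) \<longlonglongrightarrow> 0" if "k > 0" for k :: real
    using that by real_asymp
  then show "(\<lambda>n. 2 * exp (- (c * \<sigma>) * real n)) \<longlonglongrightarrow> 0" using c \<sigma> by simp
qed

text \<open>
  With \<open>L = \<pi>/(2\<sigma>)\<close>, the two angles \<open>\<beta> < \<gamma>\<close> lie slightly above \<open>L\<close>, where \<open>cos (\<sigma>y)\<close> is negative, and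
  below \<open>\<pi>\<close>; this needs \<open>L < \<pi>\<close>, that is \<open>\<sigma> > 1/2\<close>. Arguments up to halfway between \<open>\<beta>\<close> and \<open>\<gamma>\<close> are
  treated with \<open>\<gamma>\<close>, the remaining ones with \<open>\<beta>\<close>. Between \<open>L\<close> and that halfway line \<open>\<bar>exp (z\<^sup>\<sigma>)\<bar> \<le> 1\<close>, which
  makes the two descriptions fit together at \<open>L\<close>.
\<close>

theorem sector_exponential_exists:
  fixes \<sigma> :: real
  assumes "\<sigma> > 1 / 2"
  obtains E :: "complex \<Rightarrow> complex" and C :: real where "E holomorphic_on UNIV"
    and "\<And>s \<phi>. s > 0 \<Longrightarrow> \<bar>\<phi>\<bar> \<le> pi / (2 * \<sigma>) \<Longrightarrow>
           norm (E (rcis s \<phi>) - exp (rcis (s powr \<sigma>) (\<sigma> * \<phi>))) \<le> C"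
    and "\<And>s \<phi>. s > 0 \<Longrightarrow> pi / (2 * \<sigma>) \<le> \<bar>\<phi>\<bar> \<Longrightarrow> \<bar>\<phi>\<bar> \<le> pi \<Longrightarrow> norm (E (rcis s \<phi>)) \<le> C"
proof -
  have \<sigma>: "\<sigma> > 0" using assms by simp
  define L where "L = pi / (2 * \<sigma>)"
  \<comment> \<open>Four steps of length \<open>e\<close> lead from \<open>L\<close> to the end of the admissible range, given by \<open>y \<le> \<pi>\<close> and by
    \<open>cos (\<sigma>y) < 0\<close> for \<open>L < y < 3L\<close>.\<close>
  define e where "e = (min pi (3 * L) - L) / 4"
  define \<beta> \<gamma> where "\<beta> = L + e" and "\<gamma> = L + 2 * e"
  define d where "d = e / 2"
  define c where "c = sin (\<sigma> * e)"
  have L: "0 < L" "L < pi" using assms by (auto simp: L_def field_simps)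
  have \<sigma>L: "\<sigma> * L = pi / 2" using \<sigma> by (simp add: L_def)
  have e: "0 < e" "L + 4 * e \<le> pi" "2 * e \<le> L" using L by (auto simp: e_def min_def field_simps)
  have \<sigma>e: "2 * (\<sigma> * e) \<le> pi / 2" "0 < \<sigma> * e" using mult_left_mono[OF e(3), of \<sigma>] \<sigma> \<sigma>L e by auto
  have c0: "c > 0" unfolding c_def using \<sigma>e pi_gt_zero by (intro sin_gt_zero) auto
  have neg: "cos (\<sigma> * y) \<le> - c" if "\<beta> \<le> y" "y \<le> \<gamma>" for y
  proof -
    have "\<sigma> * \<beta> \<le> \<sigma> * y" "\<sigma> * y \<le> \<sigma> * \<gamma>" using that \<sigma> by auto
    then have "pi / 2 + \<sigma> * e \<le> \<sigma> * y" "\<sigma> * y \<le> pi"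
      using \<sigma>L \<sigma>e by (auto simp: \<beta>_def \<gamma>_def distrib_left)
    then have "cos (\<sigma> * y) \<le> cos (pi / 2 + \<sigma> * e)"
      using \<sigma>e pi_gt_zero by (intro cos_monotone_0_pi_le) auto
    then show ?thesis by (simp add: c_def cos_add)
  qed
  have \<beta>\<gamma>: "0 < \<beta>" "\<beta> \<le> \<gamma>" "0 < \<gamma>" "\<beta> \<le> pi - d" "\<gamma> \<le> pi - d" and d: "0 < d" "d < pi"
    using L e by (auto simp: \<beta>_def \<gamma>_def d_def)
  have n\<beta>: "cos (\<sigma> * \<beta>) \<le> - c" and n\<gamma>: "cos (\<sigma> * \<gamma>) \<le> - c" using neg \<beta>\<gamma> by auto
  obtain E where hol: "E holomorphic_on UNIV"
    and lim: "\<And>z. (\<lambda>n. arc_transform \<sigma> \<beta> (real n) z) \<longlonglongrightarrow> E z"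
    using arc_transform_limit_exists[OF n\<beta> c0 \<sigma> \<beta>\<gamma>(1)] by metis
  have lim': "(\<lambda>n. arc_transform \<sigma> \<gamma> (real n) z) \<longlonglongrightarrow> E z" for z
    using tendsto_add[OF arc_transform_angle_independent[OF c0 \<sigma> \<beta>\<gamma>(1,2) _ neg, of z] lim[of z]] \<beta>\<gamma> d by simp
  define C1 where "C1 = exp 1 + 1 / (sin d * (c * \<sigma>))"
  have big: "\<forall>\<^sub>F n in sequentially. 2 * s \<le> exp (real n)" for s :: real by real_asymp
  have in_far: "norm (E (rcis s \<phi>) - exp (rcis (s powr \<sigma>) (\<sigma> * \<phi>))) \<le> C1"
    if "s \<ge> 2" "\<bar>\<phi>\<bar> \<le> L" for s \<phi>
  proof (rule tendsto_upperbound[OF tendsto_norm[OF tendsto_diff[OF lim' tendsto_const]]])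
    show "\<forall>\<^sub>F n in sequentially. norm (arc_transform \<sigma> \<gamma> (real n) (rcis s \<phi>) - exp (rcis (s powr \<sigma>) (\<sigma> * \<phi>))) \<le> C1"
      using big[of s] unfolding C1_def
      by eventually_elim
         (rule arc_transform_estimate(1)[OF n\<gamma> c0 \<sigma> d \<beta>\<gamma>(3,5)], use that L e in \<open>auto simp: \<gamma>_def d_def\<close>)
  qed simp
  have out_far: "norm (E (rcis s \<phi>)) \<le> C1 + 1"
    if s: "s \<ge> 2" and \<phi>: "L \<le> \<bar>\<phi>\<bar>" "\<bar>\<phi>\<bar> \<le> pi" for s \<phi>
  proof (cases "\<bar>\<phi>\<bar> \<ge> \<beta> + d")
    case True
    have "norm (E (rcis s \<phi>)) \<le> C1"
    proof (rule tendsto_upperbound[OF tendsto_norm[OF lim]])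
      show "\<forall>\<^sub>F n in sequentially. norm (arc_transform \<sigma> \<beta> (real n) (rcis s \<phi>)) \<le> C1"
        using big[of s] unfolding C1_def
        by eventually_elim
           (rule arc_transform_estimate(2)[OF n\<beta> c0 \<sigma> d \<beta>\<gamma>(1,4)], use s \<phi> True in auto)
    qed simp
    then show ?thesis by simp
  next
    case False
    have "norm (E (rcis s \<phi>) - exp (rcis (s powr \<sigma>) (\<sigma> * \<phi>))) \<le> C1"
    proof (rule tendsto_upperbound[OF tendsto_norm[OF tendsto_diff[OF lim' tendsto_const]]])
      show "\<forall>\<^sub>F n in sequentially. norm (arc_transform \<sigma> \<gamma> (real n) (rcis s \<phi>) - exp (rcis (s powr \<sigma>) (\<sigma> * \<phi>))) \<le> C1"
        using big[of s] unfolding C1_def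
        by eventually_elim
           (rule arc_transform_estimate(1)[OF n\<gamma> c0 \<sigma> d \<beta>\<gamma>(3,5)], use s \<phi> False in \<open>auto simp: \<gamma>_def \<beta>_def d_def\<close>)
    qed simp
    moreover have "norm (exp (rcis (s powr \<sigma>) (\<sigma> * \<phi>))) \<le> 1"
    proof -
      have "\<sigma> * L \<le> \<sigma> * \<bar>\<phi>\<bar>" "\<sigma> * \<bar>\<phi>\<bar> \<le> \<sigma> * (L + 2 * e)"
        using \<phi> False \<sigma> by (auto simp: \<beta>_def d_def)
      then have "pi / 2 \<le> \<sigma> * \<bar>\<phi>\<bar>" "\<sigma> * \<bar>\<phi>\<bar> \<le> pi" using \<sigma>L \<sigma>e by (auto simp: distrib_left)
      then have "cos (\<sigma> * \<bar>\<phi>\<bar>) \<le> cos (pi / 2)" by (intro cos_monotone_0_pi_le) auto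
      then have "cos (\<sigma> * \<phi>) \<le> 0" by (cases "\<phi> \<ge> 0") auto
      then show ?thesis by (simp add: Re_rcis mult_nonneg_nonpos)
    qed
    ultimately show ?thesis
      using norm_triangle_ineq2[of "E (rcis s \<phi>)" "exp (rcis (s powr \<sigma>) (\<sigma> * \<phi>))"] by linarith
  qed
  have "continuous_on (cball 0 2) E"
    using holomorphic_on_imp_continuous_on[OF hol] continuous_on_subset by blast
  then have "bounded (E ` cball 0 2)"
    by (intro compact_imp_bounded compact_continuous_image) auto
  then obtain B where "\<forall>z\<in>cball 0 2. norm (E z) \<le> B"
    by (auto simp: bounded_iff)
  then have B: "\<And>z. norm z \<le> 2 \<Longrightarrow> norm (E z) \<le> B" by simp
  define C where "C = max (C1 + 1) (B + exp (2 powr \<sigma>))"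
  show ?thesis
  proof (rule that[OF hol])
    fix s \<phi> :: real assume s: "s > 0" and \<phi>: "\<bar>\<phi>\<bar> \<le> pi / (2 * \<sigma>)"
    show "norm (E (rcis s \<phi>) - exp (rcis (s powr \<sigma>) (\<sigma> * \<phi>))) \<le> C"
    proof (cases "s \<ge> 2")
      case True
      then show ?thesis using in_far[of s \<phi>] \<phi> by (simp add: C_def L_def)
    next
      case False
      have "s powr \<sigma> * cos (\<sigma> * \<phi>) \<le> s powr \<sigma> * 1" by (intro mult_left_mono) auto
      also have "\<dots> \<le> 2 powr \<sigma>" using s False \<sigma> by (simp add: powr_mono2)
      finally have "norm (exp (rcis (s powr \<sigma>) (\<sigma> * \<phi>))) \<le> exp (2 powr \<sigma>)" by (simp add: Re_rcis)
      moreover have "norm (E (rcis s \<phi>)) \<le> B" using B[of "rcis s \<phi>"] s False by simp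
      ultimately show ?thesis
        using norm_triangle_ineq4[of "E (rcis s \<phi>)" "exp (rcis (s powr \<sigma>) (\<sigma> * \<phi>))"]
        unfolding C_def by linarith
    qed
  next
    fix s \<phi> :: real assume s: "s > 0" and \<phi>: "pi / (2 * \<sigma>) \<le> \<bar>\<phi>\<bar>" "\<bar>\<phi>\<bar> \<le> pi"
    show "norm (E (rcis s \<phi>)) \<le> C"
    proof (cases "s \<ge> 2")
      case True
      then show ?thesis using out_far[of s \<phi>] \<phi> by (simp add: C_def L_def)
    next
      case False
      then have "norm (E (rcis s \<phi>)) \<le> B" using B[of "rcis s \<phi>"] s by simp
      also have "\<dots> \<le> C" unfolding C_def by (simp add: max.coboundedI2)
      finally show ?thesis .
    qed
  qed
qed

section \<open>Trapping discs and the Julia set\<close>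

lemma funpow_holomorphic:
  assumes "f holomorphic_on UNIV"
  shows "(f ^^ n) holomorphic_on UNIV"
proof (induction n)
  case 0
  then show ?case by (simp add: id_def)
next
  case (Suc n)
  show ?case
    using holomorphic_on_compose_gen[OF Suc assms] by (simp add: o_def)
qed

lemma funpow_trapped:
  fixes f :: "complex \<Rightarrow> complex"
  assumes trap: "\<And>z. norm z \<le> 1 \<Longrightarrow> norm (f z) \<le> 1 / 2"
    and z: "norm ((f ^^ m) z) \<le> 1" and mn: "m < n"
  shows "norm ((f ^^ n) z) \<le> 1 / 2"
proof -
  have "norm ((f ^^ Suc (m + k)) z) \<le> 1 / 2" for k
  proof (induction k)
    case 0
    show ?case using trap[OF z] by simp
  next
    case (Suc k)
    then have "norm (f ((f ^^ Suc (m + k)) z)) \<le> 1 / 2" by (intro trap) linarith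
    then show ?case by simp
  qed
  from this[of "n - Suc m"] show ?thesis using mn by simp
qed

text \<open>
  All iterates map \<open>W\<close> into the disc of radius \<open>1/2\<close>, so Montel's theorem applies.
\<close>

lemma fatou_set_if_trapped:
  assumes hol: "f holomorphic_on UNIV"
    and trap: "\<And>z. norm z \<le> 1 \<Longrightarrow> norm (f z) \<le> 1 / 2"
    and W: "open W" "\<And>z. z \<in> W \<Longrightarrow> norm (f z) \<le> 1 / 2"
  shows "W \<subseteq> fatou_set f"
proof
  fix z assume "z \<in> W"
  then obtain e where e: "e > 0" "ball z e \<subseteq> W" using W(1) open_contains_ball by blast
  let ?F = "{f ^^ n | n. n \<ge> 1}"
  have small: "norm (h x) \<le> 1 / 2" if "h \<in> ?F" "x \<in> W" for h x
  proof -
    obtain n where n: "h = f ^^ n" "n \<ge> 1" using \<open>h \<in> ?F\<close> by blast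
    have fx: "norm (f x) \<le> 1 / 2" by (rule W(2)[OF \<open>x \<in> W\<close>])
    show ?thesis
    proof (cases "n = 1")
      case True
      then show ?thesis using n fx by simp
    next
      case False
      then show ?thesis using n fx funpow_trapped[OF trap, where m = 1 and z = x and n = n] by simp
    qed
  qed
  have "normal_family_on (ball z e) ?F"
    unfolding normal_family_on_def
  proof (intro allI impI)
    fix g :: "nat \<Rightarrow> complex \<Rightarrow> complex" assume g: "range g \<subseteq> ?F"
    obtain h r where "strict_mono (r :: nat \<Rightarrow> nat)"
      and "\<And>K. \<lbrakk>compact K; K \<subseteq> ball z e\<rbrakk> \<Longrightarrow> uniform_limit K (g \<circ> r) h sequentially"
    proof (rule Montel[OF open_ball _ _ g])
      show "h holomorphic_on ball z e" if "h \<in> ?F" for h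
        using that funpow_holomorphic[OF hol] holomorphic_on_subset by blast
      show "\<exists>B. \<forall>h\<in>?F. \<forall>x\<in>K. norm (h x) \<le> B" if "compact K" "K \<subseteq> ball z e" for K
        using small that(2) e(2) by blast
    qed blast
    then show "\<exists>r. strict_mono r \<and>
           ((\<exists>h. \<forall>K. compact K \<and> K \<subseteq> ball z e \<longrightarrow>
                uniform_limit K (\<lambda>n. g (r n)) h sequentially) \<or>
            (\<forall>K. compact K \<and> K \<subseteq> ball z e \<longrightarrow>
                (\<forall>B::real. \<forall>\<^sub>F n in sequentially. \<forall>z\<in>K. norm (g (r n) z) > B)))"
      unfolding o_def by blast
  qed
  then show "z \<in> fatou_set f"
    unfolding fatou_set_def using e(1) by (auto intro!: exI[of _ "ball z e"])
qed

text \<open>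
  Near a Fatou point in the closure of the basin some subsequence of the iterates converges. The limit
  is not infinity, and it is bounded by \<open>1/2\<close> at nearby points of the basin; at a point whose orbit
  avoids the unit disc it would have modulus at least \<open>1\<close>, which contradicts continuity.
\<close>

lemma basin_closed_in_fatou_set:
  assumes hol: "f holomorphic_on UNIV"
    and trap: "\<And>z. norm z \<le> 1 \<Longrightarrow> norm (f z) \<le> 1 / 2"
    and z: "z \<in> fatou_set f" "z \<in> closure {z. \<exists>n. norm ((f ^^ n) z) < 1}"
  shows "\<exists>n. norm ((f ^^ n) z) < 1"
proof (rule ccontr)
  define V where "V = {z. \<exists>n. norm ((f ^^ n) z) < 1}"
  assume "\<nexists>n. norm ((f ^^ n) z) < 1"
  then have big: "norm ((f ^^ n) z) \<ge> 1" for n by (meson not_le)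
  obtain U where U: "open U" "z \<in> U" "normal_family_on U {f ^^ n | n. n \<ge> 1}"
    using z(1) unfolding fatou_set_def by blast
  have "range (\<lambda>n. f ^^ Suc n) \<subseteq> {f ^^ n | n. n \<ge> 1}" by force
  with U(3) obtain r :: "nat \<Rightarrow> nat" where r: "strict_mono r"
    and alt: "(\<exists>h. \<forall>K. compact K \<and> K \<subseteq> U \<longrightarrow> uniform_limit K (\<lambda>n. f ^^ Suc (r n)) h sequentially) \<or>
      (\<forall>K. compact K \<and> K \<subseteq> U \<longrightarrow>
         (\<forall>B::real. \<forall>\<^sub>F n in sequentially. \<forall>z\<in>K. norm ((f ^^ Suc (r n)) z) > B))"
    unfolding normal_family_on_def by (elim allE[of _ "\<lambda>n. f ^^ Suc n"]) auto
  obtain e where e: "e > 0" "cball z e \<subseteq> U" using U(1,2) open_contains_cball by blast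
  have small: "\<forall>\<^sub>F n in sequentially. norm ((f ^^ Suc (r n)) v) \<le> 1 / 2" if v: "v \<in> V" for v
  proof -
    from v obtain m where m: "norm ((f ^^ m) v) < 1" unfolding V_def by blast
    show ?thesis
      using eventually_ge_at_top[of m]
    proof eventually_elim
      case (elim n)
      then have "m < Suc (r n)" using seq_suble[OF r, of n] by simp
      then show ?case using m by (intro funpow_trapped[OF trap, where m = m]) auto
    qed
  qed
  have near: "\<exists>v\<in>V. dist v z < d" if "d > 0" for d
    using z(2) that unfolding V_def[symmetric] closure_approachable by blast
  from alt show False
  proof
    assume "\<exists>h. \<forall>K. compact K \<and> K \<subseteq> U \<longrightarrow> uniform_limit K (\<lambda>n. f ^^ Suc (r n)) h sequentially"
    then obtain h where h: "uniform_limit (cball z e) (\<lambda>n. f ^^ Suc (r n)) h sequentially"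
      using e(2) compact_cball by blast
    then obtain n where n: "\<forall>x\<in>cball z e. dist ((f ^^ Suc (r n)) x) (h x) < 1 / 8"
      using uniform_limitD[OF h, of "1 / 8"] by (auto simp: eventually_sequentially)
    have "isCont (f ^^ Suc (r n)) z"
      using holomorphic_on_imp_continuous_on[OF funpow_holomorphic[OF hol, of "Suc (r n)"]]
      by (simp add: continuous_on_eq_continuous_at del: funpow.simps)
    then obtain d where d: "d > 0"
      "\<And>x. dist x z < d \<Longrightarrow> dist ((f ^^ Suc (r n)) x) ((f ^^ Suc (r n)) z) < 1 / 8"
      unfolding continuous_at_eps_delta by (metis zero_less_divide_1_iff zero_less_numeral)
    obtain v where v: "v \<in> V" "dist v z < min d e" using near[of "min d e"] d(1) e(1) by auto
    have "(\<lambda>m. (f ^^ Suc (r m)) v) \<longlonglongrightarrow> h v"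
      by (rule tendsto_uniform_limitI[OF h]) (use v(2) in \<open>simp add: dist_commute\<close>)
    then have "norm (h v) \<le> 1 / 2"
      by (intro tendsto_upperbound[OF tendsto_norm small[OF v(1)]]) auto
    moreover have "dist ((f ^^ Suc (r n)) v) (h v) < 1 / 8"
      using n v(2) by (simp add: dist_commute)
    moreover have "dist ((f ^^ Suc (r n)) v) ((f ^^ Suc (r n)) z) < 1 / 8" using d(2) v(2) by simp
    moreover have "norm ((f ^^ Suc (r n)) z) \<le> norm ((f ^^ Suc (r n)) v)
       + dist ((f ^^ Suc (r n)) v) ((f ^^ Suc (r n)) z)"
      by (metis dist_commute dist_norm norm_triangle_sub)
    moreover have "norm ((f ^^ Suc (r n)) v) \<le> norm (h v) + dist ((f ^^ Suc (r n)) v) (h v)"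
      by (metis dist_norm norm_triangle_sub)
    ultimately show False using big[of "Suc (r n)"] by linarith
  next
    assume inf: "\<forall>K. compact K \<and> K \<subseteq> U \<longrightarrow>
         (\<forall>B::real. \<forall>\<^sub>F n in sequentially. \<forall>z\<in>K. norm ((f ^^ Suc (r n)) z) > B)"
    obtain v where v: "v \<in> V" "dist v z < e" using near[of e] e(1) by auto
    have "\<forall>\<^sub>F n in sequentially. \<forall>x\<in>cball z e. norm ((f ^^ Suc (r n)) x) > 1"
      using inf e(2) compact_cball by blast
    with small[OF v(1)] have "\<forall>\<^sub>F n in sequentially. False"
    proof eventually_elim
      case (elim n)
      then have "norm ((f ^^ Suc (r n)) v) > 1" using v(2) by (simp add: dist_commute)
      with elim(1) show False by simp
    qed
    then show False by simp
  qed
qed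

text \<open>
  Otherwise the basin of the unit disc would be a non-trivial open and closed part of \<open>Q\<close>.
\<close>

lemma connected_meets_julia_set:
  assumes hol: "f holomorphic_on UNIV"
    and trap: "\<And>z. norm z \<le> 1 \<Longrightarrow> norm (f z) \<le> 1 / 2"
    and Q: "connected Q" "z1 \<in> Q" "z2 \<in> Q"
    and z1: "norm ((f ^^ m) z1) < 1" and z2: "\<And>n. norm ((f ^^ n) z2) \<ge> 1"
  shows "Q \<inter> julia_set f \<noteq> {}"
proof
  assume "Q \<inter> julia_set f = {}"
  then have QF: "Q \<subseteq> fatou_set f" by (auto simp: julia_set_def)
  define V where "V = {z. \<exists>n. norm ((f ^^ n) z) < 1}"
  have "V = (\<Union>n. (f ^^ n) -` ball 0 1)" by (auto simp: V_def)
  moreover have "open ((f ^^ n) -` ball 0 1)" for n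
    using holomorphic_on_imp_continuous_on[OF funpow_holomorphic[OF hol, of n]]
    by (intro open_vimage open_ball)
  ultimately have "open V" by auto
  moreover have "Q \<inter> closure V \<subseteq> V"
    using basin_closed_in_fatou_set[OF hol trap] QF unfolding V_def by blast
  moreover have "z2 \<notin> V" using z2 by (auto simp: V_def not_less)
  moreover have "z1 \<in> V" using z1 by (auto simp: V_def)
  moreover have "V \<subseteq> closure V" by (rule closure_subset)
  ultimately show False
    using connectedD[OF Q(1), of V "- closure V"] Q(2,3) by auto
qed

text \<open>
  Each \<open>Q k\<close> is reached from \<open>Q 0\<close> through all its predecessors, so the sets of points that follow the
  itinerary for \<open>k\<close> steps are nested non-empty compact sets.
\<close>

lemma orbit_through_covered_compacts:
  fixes f :: "complex \<Rightarrow> complex"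
  assumes cont: "\<And>n. continuous_on UNIV (f ^^ n)"
    and Q: "\<And>k. compact (Q k)" "\<And>k. Q (Suc k) \<subseteq> f ` Q k" "\<And>k. Q k \<noteq> {}"
  obtains z where "\<And>k. (f ^^ k) z \<in> Q k"
proof -
  define B where "B = (\<lambda>k. {z. \<forall>i\<le>k. (f ^^ i) z \<in> Q i})"
  have hits: "\<exists>z\<in>B k. (f ^^ k) z = w" if "w \<in> Q k" for k w
    using that
  proof (induction k arbitrary: w)
    case 0
    then show ?case by (auto simp: B_def)
  next
    case (Suc k)
    then obtain y where y: "y \<in> Q k" "f y = w" using Q(2) by blast
    then obtain z where "z \<in> B k" "(f ^^ k) z = y" using Suc.IH by blast
    then show ?case using y Suc.prems by (auto simp: B_def le_Suc_eq)
  qed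
  have "compact (B k)" for k
  proof -
    have "B k = Q 0 \<inter> (\<Inter>i\<in>{..k}. (f ^^ i) -` Q i)" by (auto simp: B_def)
    moreover have "closed ((f ^^ i) -` Q i)" for i
      by (rule closed_vimage[OF compact_imp_closed[OF Q(1)] cont])
    ultimately show ?thesis using Q(1) by (simp add: compact_Int_closed closed_INT)
  qed
  moreover have "B k \<noteq> {}" for k using hits Q(3) by blast
  moreover have "B n \<subseteq> B m" if "m \<le> n" for m n using that by (auto simp: B_def)
  ultimately have "\<Inter> (range B) \<noteq> {}" by (intro compact_nest) auto
  then obtain z where "\<And>k. z \<in> B k" by blast
  then show ?thesis by (intro that[of z]) (auto simp: B_def)
qed

section \<open>Covering of annuli by sectors\<close>

definition sector_box :: "real \<Rightarrow> real \<Rightarrow> real \<Rightarrow> complex set" where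
  "sector_box \<theta> \<delta> r = {rcis s (\<theta> + u) | s u. r \<le> s \<and> s \<le> 2 * r \<and> \<bar>u\<bar> \<le> \<delta>}"

lemma sector_box_image:
  "sector_box \<theta> \<delta> r = (\<lambda>(s, u). rcis s (\<theta> + u)) ` ({r..2 * r} \<times> {-\<delta>..\<delta>})"
  by (force simp: sector_box_def abs_le_iff)

lemma continuous_on_rcis_pair: "continuous_on S (\<lambda>(s, u). rcis s (\<theta> + u))"
  unfolding rcis_def case_prod_beta cis_conv_exp by (intro continuous_intros)

lemma compact_sector_box: "compact (sector_box \<theta> \<delta> r)"
  unfolding sector_box_image
  by (intro compact_continuous_image continuous_on_rcis_pair compact_Times) auto

lemma connected_sector_box: "connected (sector_box \<theta> \<delta> r)"
  unfolding sector_box_image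
  by (intro connected_continuous_image continuous_on_rcis_pair connected_Times) auto

text \<open>
  Write \<open>x = z\<^sup>\<sigma>\<close>, suitably rotated. In this coordinate the box contains a disc of radius \<open>\<tau>\<rho>\<close> about \<open>p\<close>,
  proportional to \<open>r\<^sup>\<sigma>\<close> and hence far larger than the period of \<open>exp\<close>. So the logarithms of \<open>w/\<kappa>\<close> include a
  point \<open>x0\<close> well inside the disc, and Brouwer's theorem on \<open>cball x0 1\<close> corrects \<open>x0\<close> by the bounded
  error \<open>Ln q\<close>, where \<open>q\<close> is the quotient of \<open>f\<close> and its exponential model. The values \<open>w\<close> range over the
  annulus whose inner radius is the modulus of the model at the centre \<open>p\<close>.
\<close>

lemma exponential_sector_covers_annuli:
  fixes f :: "complex \<Rightarrow> complex"
  assumes cont: "continuous_on UNIV f"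
    and pos: "\<sigma> > 0" "\<kappa> > 0" "\<delta> > 0" and \<psi>: "\<bar>\<psi>\<bar> < pi / (2 * \<sigma>)"
    and approx: "\<And>s u. s \<ge> R \<Longrightarrow> \<bar>u\<bar> \<le> \<delta> \<Longrightarrow>
      norm (f (rcis s (\<theta> + u)) - of_real \<kappa> * exp (rcis (s powr \<sigma>) (\<sigma> * (\<psi> + u))))
        < \<kappa> / 2 * norm (exp (rcis (s powr \<sigma>) (\<sigma> * (\<psi> + u))))"
  shows "\<forall>\<^sub>F r in at_top. \<exists>r'\<ge>r. \<forall>w. r' \<le> norm w \<and> norm w \<le> 2 * r' \<longrightarrow> w \<in> f ` sector_box \<theta> \<delta> r"
proof -
  \<comment> \<open>A relative error \<open>\<tau>\<close> in \<open>z\<^sup>\<sigma>\<close> changes \<open>ln z\<close> by at most \<open>2\<tau>/\<sigma>\<close>. This has to stay below \<open>\<delta>\<close> for the angle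
    and below \<open>1/4\<close> for the modulus: starting from \<open>3r/2\<close>, a factor between \<open>3/4\<close> and \<open>4/3\<close> leads into \<open>[r, 2r]\<close>.\<close>
  define \<tau> where "\<tau> = min (1 / 4) (min (\<sigma> * \<delta> / 2) (\<sigma> / 8))"
  have \<tau>: "0 < \<tau>" "\<tau> < 1 / 2" "2 * \<tau> \<le> \<sigma> * \<delta>" "2 * \<tau> \<le> \<sigma> / 4"
  proof -
    have "\<tau> \<le> 1 / 4" "\<tau> \<le> \<sigma> * \<delta> / 2" "\<tau> \<le> \<sigma> / 8" "0 < \<tau>"
      using pos by (simp_all add: \<tau>_def)
    then show "0 < \<tau>" "\<tau> < 1 / 2" "2 * \<tau> \<le> \<sigma> * \<delta>" "2 * \<tau> \<le> \<sigma> / 4" by linarith+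
  qed
  define c where "c = cos (\<sigma> * \<psi>)"
  have "c > 0" unfolding c_def
    using \<psi> pos by (intro cos_gt_zero_pi) (auto simp: field_simps abs_less_iff)
  \<comment> \<open>The target \<open>x0\<close> below has distance less than \<open>5\<close> from \<open>p\<close>, and Brouwer's theorem needs the disc of
    radius \<open>1\<close> about it.\<close>
  have "\<forall>\<^sub>F r in at_top. 6 \<le> \<tau> * (3 / 2 * r) powr \<sigma>"
    using \<open>\<sigma> > 0\<close> \<open>\<tau> > 0\<close> by real_asymp
  moreover have "\<forall>\<^sub>F r in at_top. r \<le> \<kappa> * exp (c * (3 / 2 * r) powr \<sigma>)"
    using \<open>\<sigma> > 0\<close> \<open>\<kappa> > 0\<close> \<open>c > 0\<close> by real_asymp
  ultimately show ?thesis
    using eventually_ge_at_top[of "max R 1"]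
  proof eventually_elim
    case (elim r)
    then have r: "r \<ge> R" "r > 0" by auto
    define \<rho> where "\<rho> = (3 / 2 * r) powr \<sigma>"
    have \<rho>: "\<rho> > 0" "6 \<le> \<tau> * \<rho>" using elim r by (auto simp: \<rho>_def)
    define p where "p = rcis \<rho> (\<sigma> * \<psi>)"
    define Z where "Z = (\<lambda>x. cis \<theta> * exp (Ln (x * cis (- (\<sigma> * \<psi>))) / of_real \<sigma>))"
    define q where "q = (\<lambda>x. f (Z x) / (of_real \<kappa> * exp x))"
    have chart: "x * cis (- (\<sigma> * \<psi>)) \<notin> \<real>\<^sub>\<le>\<^sub>0 \<and> Z x \<in> sector_box \<theta> \<delta> r \<and> norm (q x - 1) < 1 / 2"
      if x: "norm (x - p) < \<tau> * \<rho>" for x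
    proof -
      define y where "y = x * cis (- (\<sigma> * \<psi>))"
      define \<eta> where "\<eta> = y / of_real \<rho> - 1"
      have y: "y = of_real \<rho> * (1 + \<eta>)" using \<rho> by (simp add: \<eta>_def)
      have "y - of_real \<rho> = (x - p) * cis (- (\<sigma> * \<psi>))"
        by (simp add: y_def p_def rcis_def algebra_simps cis_mult flip: mult.assoc)
      then have "norm (y - of_real \<rho>) = norm (x - p)" by (simp add: norm_mult)
      moreover have "\<eta> = (y - of_real \<rho>) / of_real \<rho>" using \<rho> by (simp add: \<eta>_def diff_divide_distrib)
      ultimately have "norm \<eta> = norm (x - p) / \<rho>" using \<rho> by (simp add: norm_divide)
      then have \<eta>: "norm \<eta> < \<tau>" using x \<rho> by (simp add: pos_divide_less_eq)
      have "\<bar>Re \<eta>\<bar> < 1 / 2" using abs_Re_le_cmod[of \<eta>] \<eta> \<tau> by linarith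
      then have "Re y > 0" unfolding y using \<rho> by simp
      then have slit: "y \<notin> \<real>\<^sub>\<le>\<^sub>0" "y \<noteq> 0" by (auto simp: complex_nonpos_Reals_iff)
      have Lny: "Ln y = of_real (ln \<rho>) + Ln (1 + \<eta>)"
        using Ln_times_of_real[of \<rho> "1 + \<eta>"] Ln_of_real[of \<rho>] \<rho> \<open>y \<noteq> 0\<close> y by auto
      have small: "norm (Ln (1 + \<eta>)) \<le> 2 * \<tau>"
        using norm_Ln_le[of \<eta>] \<eta> \<tau> by simp
      define l where "l = Ln (1 + \<eta>) / of_real \<sigma>"
      have l: "norm l \<le> \<delta>" "norm l \<le> 1 / 4"
        using small \<tau> pos by (auto simp: l_def norm_divide field_simps)
      define u where "u = Im l"
      define s where "s = 3 / 2 * r * exp (Re l)"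
      have u: "\<bar>u\<bar> \<le> \<delta>" using abs_Im_le_cmod[of l] l by (simp add: u_def)
      have lr: "\<bar>Re l\<bar> \<le> 1 / 4" using abs_Re_le_cmod[of l] l by simp
      have "exp (Re l) \<ge> 3 / 4" using exp_ge_add_one_self[of "Re l"] lr by linarith
      moreover have "exp (Re l) \<le> 4 / 3"
      proof -
        have "exp (- Re l) \<ge> 3 / 4" using exp_ge_add_one_self[of "- Re l"] lr by linarith
        then show ?thesis by (simp add: exp_minus field_simps)
      qed
      ultimately have s: "r \<le> s" "s \<le> 2 * r"
        using mult_left_mono[of "3 / 4" "exp (Re l)" "3 / 2 * r"]
          mult_left_mono[of "exp (Re l)" "4 / 3" "3 / 2 * r"] r by (auto simp: s_def)
      have Lnys: "Ln y / of_real \<sigma> = of_real (ln (3 / 2 * r)) + l"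
        unfolding Lny l_def \<rho>_def using pos r by (simp add: add_divide_distrib ln_powr)
      have Zx: "Z x = rcis s (\<theta> + u)"
      proof -
        have "exp (complex_of_real (ln (3 / 2 * r))) = of_real (3 / 2 * r)"
          using r by (simp only: exp_of_real exp_ln zero_less_mult_iff) simp
        then have "exp (Ln y / of_real \<sigma>) = of_real (3 / 2 * r) * exp l"
          unfolding Lnys exp_add by (rule arg_cong)
        also have "exp l = rcis (exp (Re l)) u" by (simp add: exp_eq_polar rcis_def u_def)
        finally have "exp (Ln y / of_real \<sigma>) = rcis s u" by (simp add: s_def rcis_def)
        moreover have "Z x = cis \<theta> * exp (Ln y / of_real \<sigma>)" by (simp only: Z_def y_def)
        ultimately show ?thesis by (simp add: rcis_def mult.left_commute cis_mult)
      qed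
      have "y = rcis (s powr \<sigma>) (\<sigma> * u)"
      proof -
        have "y = exp (of_real \<sigma> * (Ln y / of_real \<sigma>))" using slit pos by simp
        also have "\<dots> = of_real (exp (\<sigma> * ln (3 / 2 * r) + \<sigma> * Re l)) * cis (\<sigma> * u)"
          unfolding Lnys by (simp add: exp_eq_polar u_def distrib_left)
        also have "exp (\<sigma> * ln (3 / 2 * r) + \<sigma> * Re l) = s powr \<sigma>"
        proof -
          have "ln s = ln (3 / 2 * r) + Re l" unfolding s_def using r by (subst ln_mult) auto
          moreover have "s \<noteq> 0" using r s by simp
          ultimately show ?thesis by (simp add: powr_def distrib_left)
        qed
        finally show ?thesis by (simp add: rcis_def)
      qed
      moreover have "x = y * cis (\<sigma> * \<psi>)" by (simp add: y_def mult.assoc cis_mult)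
      ultimately have xs: "x = rcis (s powr \<sigma>) (\<sigma> * (\<psi> + u))"
        by (simp add: rcis_def mult.assoc cis_mult distrib_left add.commute)
      have "norm (f (Z x) - of_real \<kappa> * exp x) < \<kappa> / 2 * norm (exp x)"
        unfolding Zx unfolding xs using approx[of s u] s r u by simp
      moreover have "q x - 1 = (f (Z x) - of_real \<kappa> * exp x) / (of_real \<kappa> * exp x)"
        using pos by (simp add: q_def diff_divide_distrib)
      ultimately have "norm (q x - 1) * (\<kappa> * exp (Re x)) < 1 / 2 * (\<kappa> * exp (Re x))"
        using pos by (simp add: norm_divide norm_mult)
      then have "norm (q x - 1) < 1 / 2"
        using pos by (simp only: mult_less_cancel_right_pos mult_pos_pos exp_gt_zero)
      moreover have "Z x \<in> sector_box \<theta> \<delta> r" unfolding Zx sector_box_def using s u by blast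
      ultimately show ?thesis using slit by (simp add: y_def)
    qed
    define r' where "r' = \<kappa> * exp (Re p)"
    have "r \<le> r'" using elim by (simp add: r'_def p_def \<rho>_def c_def Re_rcis mult.commute)
    moreover have "w \<in> f ` sector_box \<theta> \<delta> r" if w: "r' \<le> norm w" "norm w \<le> 2 * r'" for w
    proof -
      have r'0: "r' > 0" using pos by (simp add: r'_def)
      then have w0: "w \<noteq> 0" using w by auto
      define v where "v = Ln (w / of_real \<kappa>)"
      \<comment> \<open>Among the logarithms of \<open>w/\<kappa>\<close>, \<open>x0\<close> is the one whose imaginary part is closest to that of \<open>p\<close>.\<close>
      define k :: int where "k = round ((Im p - Im v) / (2 * pi))"
      define x0 where "x0 = v + of_int (2 * k) * pi * \<i>"
      have ex0: "exp x0 = w / of_real \<kappa>"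
      proof -
        have "exp x0 = exp v" unfolding exp_eq x0_def by blast
        then show ?thesis using w0 pos by (simp add: v_def)
      qed
      have "\<bar>of_int k - (Im p - Im v) / (2 * pi)\<bar> \<le> 1 / 2"
        unfolding k_def by (rule of_int_round_abs_le)
      then have "\<bar>of_int k - (Im p - Im v) / (2 * pi)\<bar> * (2 * pi) \<le> 1 / 2 * (2 * pi)"
        by (rule mult_right_mono) simp
      also have "\<bar>of_int k - (Im p - Im v) / (2 * pi)\<bar> * (2 * pi) = \<bar>(of_int k - (Im p - Im v) / (2 * pi)) * (2 * pi)\<bar>"
        by (simp add: abs_mult)
      also have "(of_int k - (Im p - Im v) / (2 * pi)) * (2 * pi) = Im (x0 - p)"
        by (simp add: x0_def field_simps)
      finally have im: "\<bar>Im (x0 - p)\<bar> \<le> pi" by simp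
      have "Re x0 = Re v" by (simp add: x0_def)
      also have "Re v = ln (norm w / \<kappa>)" using w0 pos by (simp add: v_def norm_divide)
      finally have "Re x0 = ln (norm w / \<kappa>)" .
      moreover have "ln (exp (Re p)) \<le> ln (norm w / \<kappa>)"
        using w(1) w0 pos by (subst ln_le_cancel_iff) (auto simp: r'_def field_simps)
      moreover have "ln (norm w / \<kappa>) \<le> ln (2 * exp (Re p))"
        using w(2) w0 pos by (subst ln_le_cancel_iff) (auto simp: r'_def field_simps)
      moreover have "ln (2 * exp (Re p)) \<le> 1 + Re p"
        using ln_add_one_self_le_self[of 1] by (simp add: ln_mult)
      ultimately have re: "\<bar>Re (x0 - p)\<bar> \<le> 1" by simp
      have x0p: "norm (x0 - p) < 5" using cmod_le[of "x0 - p"] re im pi_less_4 by linarith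
      have near: "norm (x - p) < \<tau> * \<rho>" if "x \<in> cball x0 1" for x
        using that norm_triangle_ineq[of "x - x0" "x0 - p"] x0p \<rho>
        by (simp add: dist_norm norm_minus_commute)
      define T where "T = (\<lambda>x. x0 - Ln (q x))"
      have q: "norm (Ln (q x)) \<le> 1" "q x \<notin> \<real>\<^sub>\<le>\<^sub>0" "q x \<noteq> 0" if "x \<in> cball x0 1" for x
      proof -
        have n: "norm (q x - 1) < 1 / 2" using chart[OF near[OF that]] by blast
        show "norm (Ln (q x)) \<le> 1" using norm_Ln_le[OF n] n by simp
        have "Re (q x) > 0" using abs_Re_le_cmod[of "q x - 1"] n by simp
        then show "q x \<notin> \<real>\<^sub>\<le>\<^sub>0" "q x \<noteq> 0" by (auto simp: complex_nonpos_Reals_iff)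
      qed
      have "continuous_on (cball x0 1) Z"
        unfolding Z_def using chart near pos
        by (intro continuous_intros) (auto simp: nonpos_Reals_def)
      then have "continuous_on (cball x0 1) (\<lambda>x. f (Z x))"
        by (intro continuous_on_compose2[OF cont]) auto
      then have "continuous_on (cball x0 1) q"
        unfolding q_def using pos by (intro continuous_intros) auto
      then have "continuous_on (cball x0 1) T"
        unfolding T_def using q by (intro continuous_intros) auto
      moreover have "T \<in> cball x0 1 \<rightarrow> cball x0 1"
        using q by (auto simp: T_def dist_norm)
      ultimately obtain x where x: "x \<in> cball x0 1" "T x = x"
        using brouwer_ball[of 1 x0 T] by auto
      have "exp x * q x = exp x0"
      proof -
        have "x0 = x + Ln (q x)" using x(2) unfolding T_def by (metis diff_add_cancel)
        then have "exp x0 = exp x * exp (Ln (q x))" by (simp only: exp_add)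
        then show ?thesis using q(3)[OF x(1)] by simp
      qed
      then have "f (Z x) = w"
        using ex0 pos by (simp add: q_def field_simps)
      then show ?thesis using chart[OF near[OF x(1)]] by blast
    qed
    ultimately show ?case by blast
  qed
qed

text \<open>
  An itinerary through boxes with ever larger radii gives a point that never enters the unit disc. A
  point of the first box that is mapped to the ray of direction \<open>\<alpha>\<close> enters it after two steps.
\<close>

lemma covering_sector_contains_julia_points:
  assumes hol: "f holomorphic_on UNIV"
    and trap: "\<And>z. norm z \<le> 1 \<Longrightarrow> norm (f z) \<le> 1 / 2"
    and ray: "\<And>s. s > 0 \<Longrightarrow> norm (f (rcis s \<alpha>)) \<le> 1 / 2"
    and \<delta>: "\<delta> > 0"
    and cover: "\<forall>\<^sub>F r in at_top. \<exists>r'\<ge>r. \<forall>w. r' \<le> norm w \<and> norm w \<le> 2 * r' \<longrightarrow> w \<in> f ` sector_box \<theta> \<delta> r"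
  shows "\<exists>s u. s \<ge> R \<and> \<bar>u\<bar> \<le> \<delta> \<and> rcis s (\<theta> + u) \<in> julia_set f"
proof -
  obtain R0 where "\<forall>r\<ge>R0. \<exists>r'\<ge>r. \<forall>w. r' \<le> norm w \<and> norm w \<le> 2 * r' \<longrightarrow> w \<in> f ` sector_box \<theta> \<delta> r"
    using cover by (auto simp: eventually_at_top_linorder)
  then obtain g where g: "\<And>r. r \<ge> R0 \<Longrightarrow> g r \<ge> r"
    "\<And>r w. r \<ge> R0 \<Longrightarrow> g r \<le> norm w \<Longrightarrow> norm w \<le> 2 * g r \<Longrightarrow> w \<in> f ` sector_box \<theta> \<delta> r"
    by metis
  define a where "a = max R0 (max R 1)"
  define r where "r = (\<lambda>k. (g ^^ k) a)"
  have ra: "r k \<ge> a" for k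
  proof (induction k)
    case (Suc k)
    then show ?case using g(1)[of "r k"] by (simp add: r_def a_def)
  qed (simp add: r_def)
  then have rR: "r k \<ge> R0" "r k \<ge> 1" "r k \<ge> R" for k by (metis a_def max.bounded_iff)+
  have nrm: "r k \<le> norm w \<and> norm w \<le> 2 * r k" if "w \<in> sector_box \<theta> \<delta> (r k)" for w k
    using that rR(2)[of k] by (auto simp: sector_box_def)
  have contf: "continuous_on UNIV (f ^^ n)" for n
    by (rule holomorphic_on_imp_continuous_on[OF funpow_holomorphic[OF hol]])
  have ne: "sector_box \<theta> \<delta> (r k) \<noteq> {}" for k
  proof -
    have "rcis (r k) (\<theta> + 0) \<in> sector_box \<theta> \<delta> (r k)"
      unfolding sector_box_def using \<delta> rR(2)[of k]
      by (intro CollectI exI[of _ "r k"] exI[of _ 0]) auto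
    then show ?thesis by blast
  qed
  have step: "w \<in> f ` sector_box \<theta> \<delta> (r k)" if "r (Suc k) \<le> norm w" "norm w \<le> 2 * r (Suc k)" for w k
    using g(2)[OF rR(1)[of k]] that by (simp add: r_def)
  obtain z2 where z2: "\<And>k. (f ^^ k) z2 \<in> sector_box \<theta> \<delta> (r k)"
  proof (rule orbit_through_covered_compacts[OF contf compact_sector_box _ ne])
    show "sector_box \<theta> \<delta> (r (Suc k)) \<subseteq> f ` sector_box \<theta> \<delta> (r k)" for k
      using step nrm by blast
  qed blast
  have "rcis (r 1) \<alpha> \<in> f ` sector_box \<theta> \<delta> (r 0)"
    using rR(2)[of 1] by (intro step) auto
  then obtain z1 where z1: "z1 \<in> sector_box \<theta> \<delta> (r 0)" "f z1 = rcis (r 1) \<alpha>" by force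
  have "norm ((f ^^ 2) z1) \<le> 1 / 2"
    using z1(2) ray[of "r 1"] rR(2)[of 1] by (simp add: numeral_2_eq_2)
  then have small: "norm ((f ^^ 2) z1) < 1" by linarith
  have big: "norm ((f ^^ k) z2) \<ge> 1" for k
    using nrm[OF z2[of k]] rR(2)[of k] by linarith
  have "z2 \<in> sector_box \<theta> \<delta> (r 0)" using z2[of 0] by simp
  then have "sector_box \<theta> \<delta> (r 0) \<inter> julia_set f \<noteq> {}"
    by (intro connected_meets_julia_set[OF hol trap connected_sector_box z1(1) _ small big])
  then obtain s u where "r 0 \<le> s" "\<bar>u\<bar> \<le> \<delta>" "rcis s (\<theta> + u) \<in> julia_set f"
    unfolding sector_box_def by blast
  then show ?thesis using rR(3)[of 0] by (meson order_trans)
qed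

section \<open>Superpositions of rotated sector exponentials\<close>

lemma nearest_angle:
  obtains k :: int where "\<bar>x + 2 * pi * of_int k\<bar> \<le> pi"
proof
  have "\<bar>of_int (round (x / (2 * pi))) - x / (2 * pi)\<bar> * (2 * pi) \<le> 1 / 2 * (2 * pi)"
    by (intro mult_right_mono of_int_round_abs_le) simp
  also have "\<bar>of_int (round (x / (2 * pi))) - x / (2 * pi)\<bar> * (2 * pi) =
      \<bar>(of_int (round (x / (2 * pi))) - x / (2 * pi)) * (2 * pi)\<bar>"
    by (simp add: abs_mult)
  also have "(of_int (round (x / (2 * pi))) - x / (2 * pi)) * (2 * pi) = - (x + 2 * pi * of_int (- round (x / (2 * pi))))"
    by (simp add: field_simps)
  finally show "\<bar>x + 2 * pi * of_int (- round (x / (2 * pi)))\<bar> \<le> pi" by simp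
qed

lemma cos_shift: "cos (x + 2 * pi * of_int k) = cos x"
  by (metis cos_int_2pin cos_add mult.commute sin_int_2pin mult_zero_right mult_1_right diff_zero)

lemma sin_shift: "sin (x + 2 * pi * of_int k) = sin x"
  by (simp add: sin_add)

lemma rcis_shift: "rcis s (x + 2 * pi * of_int k) = rcis s x"
  by (simp add: rcis_def complex_eq_iff cos_shift sin_shift)

lemma cos_ge_imp_near:
  assumes "0 \<le> h" "h \<le> pi" "cos h \<le> cos x"
  obtains k :: int where "\<bar>x + 2 * pi * of_int k\<bar> \<le> h"
proof -
  obtain k :: int where k: "\<bar>x + 2 * pi * of_int k\<bar> \<le> pi" by (rule nearest_angle)
  have "\<not> h < \<bar>x + 2 * pi * of_int k\<bar>"
  proof
    assume "h < \<bar>x + 2 * pi * of_int k\<bar>"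
    then have "cos \<bar>x + 2 * pi * of_int k\<bar> < cos h" using assms k by (intro cos_monotone_0_pi) auto
    then show False using assms by (simp add: cos_shift)
  qed
  then have "\<bar>x + 2 * pi * of_int k\<bar> \<le> h" by simp
  then show ?thesis by (rule that)
qed

lemma cos_gt_imp_near:
  assumes "0 \<le> h" "h \<le> pi" "cos h < cos x"
  obtains k :: int where "\<bar>x + 2 * pi * of_int k\<bar> < h"
proof -
  obtain k :: int where k: "\<bar>x + 2 * pi * of_int k\<bar> \<le> h"
    using cos_ge_imp_near[of h x] assms by auto
  have "\<bar>x + 2 * pi * of_int k\<bar> \<noteq> h"
    using assms(3) cos_shift[of x k] by (metis cos_abs_real less_irrefl)
  then have "\<bar>x + 2 * pi * of_int k\<bar> < h" using k by simp
  then show ?thesis by (rule that)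
qed

text \<open>
  The estimates with angles taken modulo \<open>2\<pi>\<close>: membership of a direction in the sector is expressed
  by comparing cosines.
\<close>

lemma sector_exponential_family:
  obtains E :: "real \<Rightarrow> complex \<Rightarrow> complex" and C :: "real \<Rightarrow> real" where
    "\<And>\<sigma>. \<sigma> > 1 / 2 \<Longrightarrow> E \<sigma> holomorphic_on UNIV" "\<And>\<sigma>. C \<sigma> \<ge> 0"
    "\<And>\<sigma> s \<phi>. \<sigma> > 1 / 2 \<Longrightarrow> s > 0 \<Longrightarrow> \<bar>\<phi>\<bar> \<le> pi / (2 * \<sigma>) \<Longrightarrow>
           norm (E \<sigma> (rcis s \<phi>) - exp (rcis (s powr \<sigma>) (\<sigma> * \<phi>))) \<le> C \<sigma>"
    "\<And>\<sigma> s \<phi>. \<sigma> > 1 / 2 \<Longrightarrow> s > 0 \<Longrightarrow> cos \<phi> \<le> cos (pi / (2 * \<sigma>)) \<Longrightarrow> norm (E \<sigma> (rcis s \<phi>)) \<le> C \<sigma>"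
    "\<And>\<sigma> s \<phi>. \<sigma> > 1 / 2 \<Longrightarrow> s > 0 \<Longrightarrow> norm (E \<sigma> (rcis s \<phi>)) \<le> C \<sigma> + exp (s powr \<sigma>)"
proof -
  have "\<exists>E C. E holomorphic_on UNIV \<and> C \<ge> 0 \<and>
    (\<forall>s \<phi>. s > 0 \<longrightarrow> \<bar>\<phi>\<bar> \<le> pi / (2 * \<sigma>) \<longrightarrow>
           norm (E (rcis s \<phi>) - exp (rcis (s powr \<sigma>) (\<sigma> * \<phi>))) \<le> C) \<and>
    (\<forall>s \<phi>. s > 0 \<longrightarrow> cos \<phi> \<le> cos (pi / (2 * \<sigma>)) \<longrightarrow> norm (E (rcis s \<phi>)) \<le> C) \<and>
    (\<forall>s \<phi>. s > 0 \<longrightarrow> norm (E (rcis s \<phi>)) \<le> C + exp (s powr \<sigma>))" if \<sigma>: "\<sigma> > 1 / 2" for \<sigma> :: real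
  proof -
    obtain E C where hol: "E holomorphic_on UNIV"
      and inn: "\<And>s \<phi>. s > 0 \<Longrightarrow> \<bar>\<phi>\<bar> \<le> pi / (2 * \<sigma>) \<Longrightarrow>
           norm (E (rcis s \<phi>) - exp (rcis (s powr \<sigma>) (\<sigma> * \<phi>))) \<le> C"
      and out: "\<And>s \<phi>. s > 0 \<Longrightarrow> pi / (2 * \<sigma>) \<le> \<bar>\<phi>\<bar> \<Longrightarrow> \<bar>\<phi>\<bar> \<le> pi \<Longrightarrow> norm (E (rcis s \<phi>)) \<le> C"
      using sector_exponential_exists[OF \<sigma>] by metis
    have h: "0 \<le> pi / (2 * \<sigma>)" "pi / (2 * \<sigma>) \<le> pi" using \<sigma> by (auto simp: field_simps)
    have C: "C \<ge> 0" using inn[of 1 0] h norm_ge_zero order_trans by (metis abs_zero zero_less_one)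
    have out': "norm (E (rcis s \<phi>)) \<le> C" if s: "s > 0" and c: "cos \<phi> \<le> cos (pi / (2 * \<sigma>))" for s \<phi>
    proof -
      obtain k :: int where k: "\<bar>\<phi> + 2 * pi * of_int k\<bar> \<le> pi" by (rule nearest_angle)
      have "\<not> \<bar>\<phi> + 2 * pi * of_int k\<bar> < pi / (2 * \<sigma>)"
      proof
        assume "\<bar>\<phi> + 2 * pi * of_int k\<bar> < pi / (2 * \<sigma>)"
        then have "cos (pi / (2 * \<sigma>)) < cos \<bar>\<phi> + 2 * pi * of_int k\<bar>" using h by (intro cos_monotone_0_pi) auto
        then show False using c by (simp add: cos_shift)
      qed
      then show ?thesis using out[OF s _ k] by (simp add: rcis_shift)
    qed
    have all: "norm (E (rcis s \<phi>)) \<le> C + exp (s powr \<sigma>)" if s: "s > 0" for s \<phi>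
    proof -
      obtain k :: int where k: "\<bar>\<phi> + 2 * pi * of_int k\<bar> \<le> pi" by (rule nearest_angle)
      let ?y = "\<phi> + 2 * pi * of_int k"
      show ?thesis
      proof (cases "\<bar>?y\<bar> \<le> pi / (2 * \<sigma>)")
        case True
        have "s powr \<sigma> * cos (\<sigma> * ?y) \<le> s powr \<sigma> * 1" by (intro mult_left_mono) auto
        then have "norm (exp (rcis (s powr \<sigma>) (\<sigma> * ?y))) \<le> exp (s powr \<sigma>)" by (simp add: Re_rcis)
        moreover have "norm (E (rcis s ?y)) \<le> norm (E (rcis s ?y) - exp (rcis (s powr \<sigma>) (\<sigma> * ?y)))
            + norm (exp (rcis (s powr \<sigma>) (\<sigma> * ?y)))"
          by (metis add.commute norm_triangle_sub)
        ultimately have "norm (E (rcis s ?y)) \<le> C + exp (s powr \<sigma>)" using inn[OF s True] by linarith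
        then show ?thesis by (simp add: rcis_shift)
      next
        case False
        then have "norm (E (rcis s ?y)) \<le> C" using out[OF s _ k] by simp
        then show ?thesis by (simp add: rcis_shift add_increasing2)
      qed
    qed
    show ?thesis using hol C inn out' all by blast
  qed
  then obtain E C where "\<And>\<sigma>::real. \<sigma> > 1 / 2 \<Longrightarrow> E \<sigma> holomorphic_on UNIV \<and> C \<sigma> \<ge> 0 \<and>
    (\<forall>s \<phi>. s > 0 \<longrightarrow> \<bar>\<phi>\<bar> \<le> pi / (2 * \<sigma>) \<longrightarrow>
           norm (E \<sigma> (rcis s \<phi>) - exp (rcis (s powr \<sigma>) (\<sigma> * \<phi>))) \<le> C \<sigma>) \<and>
    (\<forall>s \<phi>. s > 0 \<longrightarrow> cos \<phi> \<le> cos (pi / (2 * \<sigma>)) \<longrightarrow> norm (E \<sigma> (rcis s \<phi>)) \<le> C \<sigma>) \<and>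
    (\<forall>s \<phi>. s > 0 \<longrightarrow> norm (E \<sigma> (rcis s \<phi>)) \<le> C \<sigma> + exp (s powr \<sigma>))"
    by metis
  then show ?thesis using that[of E "\<lambda>\<sigma>. if \<sigma> > 1 / 2 then C \<sigma> else 0"] by auto
qed

text \<open>
  A pair \<open>(c, \<sigma>)\<close> stands for the sector of order \<open>\<sigma>\<close> with axis \<open>c\<close> and half-opening \<open>\<pi>/(2\<sigma>)\<close>. In a
  dominated direction the summand belonging to \<open>p\<close> is exponentially larger than all others
  together: each of them is bounded there or has smaller order.
\<close>

definition dominates :: "(real \<times> real) set \<Rightarrow> real \<times> real \<Rightarrow> real \<Rightarrow> bool" where
  "dominates J p \<theta> \<longleftrightarrow> p \<in> J \<and> cos (\<theta> - fst p) > cos (pi / (2 * snd p)) \<and>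
     (\<forall>q\<in>J - {p}. snd q < snd p \<or> cos (\<theta> - fst q) < cos (pi / (2 * snd q)))"

lemma power_exp_dominated:
  fixes a b m B N :: real
  assumes "a < b" "0 < a" "m > 0" "N > 0"
  shows "\<forall>\<^sub>F s in at_top. B + exp (s powr a) \<le> exp (m * s powr b) / N"
proof -
  have "b > 0" "b - a > 0" using assms by auto
  then show ?thesis using assms by real_asymp
qed

text \<open>
  The function is \<open>\<kappa>\<close> times the sum of the rotated sector exponentials, with \<open>\<kappa>\<close> so small that the
  bounds on the unit disc and on the common complement of the sectors become \<open>1/2\<close>. The last
  property is the exponential model in dominated directions: every error term is eventually at most
  \<open>exp (m s\<^sup>\<sigma>) / (4 card J)\<close>, while the model has modulus at least \<open>exp (m s\<^sup>\<sigma>)\<close>.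
\<close>

lemma superposition_exists:
  assumes J: "finite J" "J \<noteq> {}" and \<rho>: "\<And>p. p \<in> J \<Longrightarrow> snd p > 1 / 2 \<and> snd p \<le> \<rho>"
  obtains f :: "complex \<Rightarrow> complex" and \<kappa> A :: real where "f holomorphic_on UNIV" "\<kappa> > 0"
    and "\<And>z. norm z \<le> 1 \<Longrightarrow> norm (f z) \<le> 1 / 2"
    and "\<And>s \<phi>. s > 0 \<Longrightarrow> \<forall>p\<in>J. cos (\<phi> - fst p) \<le> cos (pi / (2 * snd p)) \<Longrightarrow>
           norm (f (rcis s \<phi>)) \<le> 1 / 2"
    and "\<And>s \<phi>. s \<ge> 1 \<Longrightarrow> norm (f (rcis s \<phi>)) \<le> A * exp (s powr \<rho>)"
    and "\<And>p \<theta>. dominates J p \<theta> \<Longrightarrow> \<exists>\<delta>>0. \<exists>\<psi> R. \<exists>m>0. \<bar>\<psi>\<bar> < pi / (2 * snd p) \<and>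
           (\<forall>s\<ge>R. \<forall>u. \<bar>u\<bar> \<le> \<delta> \<longrightarrow> cos (snd p * (\<psi> + u)) \<ge> m \<and>
              norm (f (rcis s (\<theta> + u)) - of_real \<kappa> * exp (rcis (s powr snd p) (snd p * (\<psi> + u))))
                < \<kappa> / 2 * norm (exp (rcis (s powr snd p) (snd p * (\<psi> + u)))))"
proof -
  obtain E :: "real \<Rightarrow> complex \<Rightarrow> complex" and C where
    hol: "\<And>\<sigma>. \<sigma> > 1 / 2 \<Longrightarrow> E \<sigma> holomorphic_on UNIV" and C: "\<And>\<sigma>. C \<sigma> \<ge> 0" and
    inn: "\<And>\<sigma> s \<phi>. \<sigma> > 1 / 2 \<Longrightarrow> s > 0 \<Longrightarrow> \<bar>\<phi>\<bar> \<le> pi / (2 * \<sigma>) \<Longrightarrow>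
           norm (E \<sigma> (rcis s \<phi>) - exp (rcis (s powr \<sigma>) (\<sigma> * \<phi>))) \<le> C \<sigma>" and
    out: "\<And>\<sigma> s \<phi>. \<sigma> > 1 / 2 \<Longrightarrow> s > 0 \<Longrightarrow> cos \<phi> \<le> cos (pi / (2 * \<sigma>)) \<Longrightarrow> norm (E \<sigma> (rcis s \<phi>)) \<le> C \<sigma>" and
    all: "\<And>\<sigma> s \<phi>. \<sigma> > 1 / 2 \<Longrightarrow> s > 0 \<Longrightarrow> norm (E \<sigma> (rcis s \<phi>)) \<le> C \<sigma> + exp (s powr \<sigma>)"
    by (rule sector_exponential_family, rule that)
  define S where "S = (\<lambda>z. \<Sum>p\<in>J. E (snd p) (z * cis (- fst p)))"
  have holS: "S holomorphic_on UNIV"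
    unfolding S_def
  proof (intro holomorphic_on_sum)
    fix p assume "p \<in> J"
    then have "E (snd p) holomorphic_on UNIV" using \<rho> hol by blast
    then have "(E (snd p) \<circ> (\<lambda>z. z * cis (- fst p))) holomorphic_on UNIV"
      by (intro holomorphic_on_compose_gen[of _ UNIV _ UNIV] holomorphic_intros) auto
    then show "(\<lambda>z. E (snd p) (z * cis (- fst p))) holomorphic_on UNIV" by (simp add: o_def)
  qed
  have S_rcis: "S (rcis s \<phi>) = (\<Sum>p\<in>J. E (snd p) (rcis s (\<phi> - fst p)))" for s \<phi>
    unfolding S_def by (simp add: rcis_def cis_mult mult.assoc)
  have "continuous_on (cball 0 1) S"
    using holomorphic_on_imp_continuous_on[OF holS] by (rule continuous_on_subset) simp
  then have "bounded (S ` cball 0 1)"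
    by (intro compact_imp_bounded compact_continuous_image) auto
  then obtain B where "\<forall>z\<in>cball 0 1. norm (S z) \<le> B" by (auto simp: bounded_iff)
  then have B: "norm (S z) \<le> B" if "norm z \<le> 1" for z using that by simp
  define D where "D = (\<Sum>p\<in>J. C (snd p))"
  define \<kappa> where "\<kappa> = 1 / (2 * (\<bar>B\<bar> + \<bar>D\<bar> + 1))"
  have den: "\<bar>B\<bar> + \<bar>D\<bar> + 1 > 0" by linarith
  have \<kappa>: "\<kappa> > 0" unfolding \<kappa>_def using den by simp
  have small: "norm (of_real \<kappa> * S z) \<le> 1 / 2" if "norm (S z) \<le> B \<or> norm (S z) \<le> D" for z
  proof -
    have "norm (S z) \<le> \<bar>B\<bar> + \<bar>D\<bar> + 1" using that by linarith
    then have "\<kappa> * norm (S z) \<le> \<kappa> * (\<bar>B\<bar> + \<bar>D\<bar> + 1)" using \<kappa> by (intro mult_left_mono) auto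
    also have "\<dots> = 1 / 2" unfolding \<kappa>_def using den by simp
    finally show ?thesis using \<kappa> by (simp add: norm_mult)
  qed
  show ?thesis
  proof (rule that[of "\<lambda>z. of_real \<kappa> * S z" \<kappa> "\<kappa> * (\<Sum>p\<in>J. C (snd p) + 1)"])
    show "(\<lambda>z. of_real \<kappa> * S z) holomorphic_on UNIV" by (intro holomorphic_intros holS)
    show "\<kappa> > 0" by (rule \<kappa>)
    show "norm (of_real \<kappa> * S z) \<le> 1 / 2" if "norm z \<le> 1" for z
      using small B[OF that] by blast
  next
    fix s \<phi> :: real assume s: "s > 0" and far: "\<forall>p\<in>J. cos (\<phi> - fst p) \<le> cos (pi / (2 * snd p))"
    have "norm (S (rcis s \<phi>)) \<le> D"
      unfolding S_rcis D_def using s far \<rho> by (intro sum_norm_le out) auto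
    then show "norm (of_real \<kappa> * S (rcis s \<phi>)) \<le> 1 / 2" using small by blast
  next
    fix s \<phi> :: real assume s: "s \<ge> 1"
    have "norm (S (rcis s \<phi>)) \<le> (\<Sum>p\<in>J. (C (snd p) + 1) * exp (s powr \<rho>))"
      unfolding S_rcis
    proof (rule sum_norm_le)
      fix p assume p: "p \<in> J"
      have "norm (E (snd p) (rcis s (\<phi> - fst p))) \<le> C (snd p) + exp (s powr snd p)"
        using \<rho>[OF p] s by (intro all) auto
      also have "\<dots> \<le> C (snd p) * exp (s powr \<rho>) + 1 * exp (s powr \<rho>)"
        using \<rho>[OF p] s C[of "snd p"] mult_left_mono[of 1 "exp (s powr \<rho>)" "C (snd p)"]
        by (intro add_mono) (auto intro: powr_mono)
      finally show "norm (E (snd p) (rcis s (\<phi> - fst p))) \<le> (C (snd p) + 1) * exp (s powr \<rho>)"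
        by (simp add: algebra_simps)
    qed
    then have "norm (S (rcis s \<phi>)) \<le> (\<Sum>p\<in>J. C (snd p) + 1) * exp (s powr \<rho>)"
      by (simp add: sum_distrib_right)
    then show "norm (of_real \<kappa> * S (rcis s \<phi>)) \<le> \<kappa> * (\<Sum>p\<in>J. C (snd p) + 1) * exp (s powr \<rho>)"
      using \<kappa> mult_left_mono[of _ _ \<kappa>] by (simp add: norm_mult mult.assoc)
  next
    fix p \<theta> assume "dominates J p \<theta>"
    then have p: "p \<in> J" "cos (\<theta> - fst p) > cos (pi / (2 * snd p))"
      and others: "\<And>q. q \<in> J \<Longrightarrow> q \<noteq> p \<Longrightarrow> snd q < snd p \<or> cos (\<theta> - fst q) < cos (pi / (2 * snd q))"
      by (auto simp: dominates_def)
    define c \<sigma> where "c = fst p" and "\<sigma> = snd p"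
    have \<sigma>: "\<sigma> > 1 / 2" using \<rho>[OF p(1)] by (simp add: \<sigma>_def)
    have h: "0 < pi / (2 * \<sigma>)" "pi / (2 * \<sigma>) \<le> pi" using \<sigma> by (auto simp: field_simps)
    obtain k :: int where "\<bar>(\<theta> - c) + 2 * pi * of_int k\<bar> < pi / (2 * \<sigma>)"
      using cos_gt_imp_near[of "pi / (2 * \<sigma>)" "\<theta> - c"] h p(2) unfolding c_def \<sigma>_def by force
    then obtain \<psi> where \<psi>: "\<psi> = (\<theta> - c) + 2 * pi * of_int k" "\<bar>\<psi>\<bar> < pi / (2 * \<sigma>)" by blast
    have "\<forall>q\<in>J. \<forall>\<^sub>F u in nhds 0. q \<noteq> p \<and> \<not> snd q < \<sigma> \<longrightarrow> cos (\<theta> + u - fst q) < cos (pi / (2 * snd q))"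
    proof
      fix q assume q: "q \<in> J"
      show "\<forall>\<^sub>F u in nhds 0. q \<noteq> p \<and> \<not> snd q < \<sigma> \<longrightarrow> cos (\<theta> + u - fst q) < cos (pi / (2 * snd q))"
      proof (cases "q \<noteq> p \<and> \<not> snd q < \<sigma>")
        case True
        then have "cos (\<theta> + 0 - fst q) < cos (pi / (2 * snd q))" using others[OF q] by (auto simp: \<sigma>_def)
        moreover have "((\<lambda>u. cos (\<theta> + u - fst q)) \<longlongrightarrow> cos (\<theta> + 0 - fst q)) (nhds 0)"
          by (intro tendsto_intros filterlim_ident)
        ultimately show ?thesis using order_tendstoD(2) by (fastforce elim: eventually_mono)
      qed auto
    qed
    then have "\<forall>\<^sub>F u in nhds 0. \<forall>q\<in>J. q \<noteq> p \<and> \<not> snd q < \<sigma> \<longrightarrow> cos (\<theta> + u - fst q) < cos (pi / (2 * snd q))"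
      by (rule eventually_ball_finite[OF J(1)])
    then obtain \<delta>1 where \<delta>1: "\<delta>1 > 0"
      "\<And>u q. \<bar>u\<bar> < \<delta>1 \<Longrightarrow> q \<in> J \<Longrightarrow> q \<noteq> p \<Longrightarrow> \<not> snd q < \<sigma> \<Longrightarrow> cos (\<theta> + u - fst q) < cos (pi / (2 * snd q))"
      unfolding eventually_nhds_metric by (auto simp: dist_real_def)
    \<comment> \<open>Within \<open>\<delta>\<close> of \<open>\<theta>\<close> the other sectors keep their relation to the direction, and the angle to the axis
      of \<open>p\<close> stays so far below \<open>\<pi>/(2\<sigma>)\<close> that the cosine is bounded below by \<open>m\<close>.\<close>
    define \<delta> where "\<delta> = min (\<delta>1 / 2) ((pi / (2 * \<sigma>) - \<bar>\<psi>\<bar>) / 2)"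
    have \<delta>: "\<delta> > 0" "\<delta> < \<delta>1" "\<bar>\<psi>\<bar> + \<delta> < pi / (2 * \<sigma>)"
      using \<delta>1(1) \<psi>(2) by (auto simp: \<delta>_def min_def field_simps)
    define m where "m = cos (\<sigma> * (\<bar>\<psi>\<bar> + \<delta>))"
    have a: "0 \<le> \<sigma> * (\<bar>\<psi>\<bar> + \<delta>)" "\<sigma> * (\<bar>\<psi>\<bar> + \<delta>) < pi / 2"
      using \<sigma> \<delta> by (auto simp: field_simps)
    have m: "m > 0" unfolding m_def using a by (intro cos_gt_zero_pi) auto
    have cosm: "cos (\<sigma> * (\<psi> + u)) \<ge> m" if "\<bar>u\<bar> \<le> \<delta>" for u
    proof -
      have "\<sigma> * \<bar>\<psi> + u\<bar> \<le> \<sigma> * (\<bar>\<psi>\<bar> + \<delta>)" using that \<sigma> by (intro mult_left_mono) auto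
      then have "\<bar>\<sigma> * (\<psi> + u)\<bar> \<le> \<sigma> * (\<bar>\<psi>\<bar> + \<delta>)" using \<sigma> by (simp add: abs_mult)
      then have "cos (\<sigma> * (\<bar>\<psi>\<bar> + \<delta>)) \<le> cos \<bar>\<sigma> * (\<psi> + u)\<bar>" using a by (intro cos_monotone_0_pi_le) auto
      then show ?thesis by (simp add: m_def)
    qed
    define N where "N = 4 * real (card J)"
    have N: "N > 0" using J by (simp add: N_def card_gt_0_iff)
    define X where "X = (\<lambda>s u. rcis (s powr \<sigma>) (\<sigma> * (\<psi> + u)))"
    define T where "T = (\<lambda>q s u. E (snd q) (rcis s (\<theta> + u - fst q)) - (if q = p then exp (X s u) else 0))"
    have "\<forall>q\<in>J. \<forall>\<^sub>F s in at_top. \<forall>u. \<bar>u\<bar> \<le> \<delta> \<longrightarrow> norm (T q s u) \<le> exp (m * s powr \<sigma>) / N"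
    proof
      fix q assume q: "q \<in> J"
      have \<sigma>q: "snd q > 1 / 2" using \<rho>[OF q] by simp
      \<comment> \<open>Only the constant matters here; \<open>1/4\<close> is an arbitrary exponent below \<open>\<sigma>\<close>.\<close>
      have "\<forall>\<^sub>F s in at_top. C (snd q) + exp (s powr (1/4)) \<le> exp (m * s powr \<sigma>) / N"
        using \<sigma> m N by (intro power_exp_dominated) auto
      then have ev: "\<forall>\<^sub>F s in at_top. C (snd q) \<le> exp (m * s powr \<sigma>) / N"
        by eventually_elim (smt (verit) exp_gt_zero)
      consider "q = p" | "q \<noteq> p" "snd q < \<sigma>" | "q \<noteq> p" "\<not> snd q < \<sigma>" by blast
      then show "\<forall>\<^sub>F s in at_top. \<forall>u. \<bar>u\<bar> \<le> \<delta> \<longrightarrow> norm (T q s u) \<le> exp (m * s powr \<sigma>) / N"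
      proof cases
        case 1
        show ?thesis
          using ev eventually_gt_at_top[of 0]
        proof eventually_elim
          case (elim s)
          show ?case
          proof (intro allI impI)
            fix u assume u: "\<bar>u\<bar> \<le> \<delta>"
            have "rcis s (\<theta> + u - fst q) = rcis s (\<psi> + u)"
              using rcis_shift[of s "\<theta> + u - c" k] by (simp add: \<psi>(1) 1 c_def algebra_simps)
            then have "T q s u = E \<sigma> (rcis s (\<psi> + u)) - exp (rcis (s powr \<sigma>) (\<sigma> * (\<psi> + u)))"
              by (simp add: T_def X_def 1 \<sigma>_def)
            also have "norm \<dots> \<le> C \<sigma>" using u \<delta> elim by (intro inn[OF \<sigma>]) auto
            finally show "norm (T q s u) \<le> exp (m * s powr \<sigma>) / N" using elim 1 by (simp add: \<sigma>_def)
          qed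
        qed
      next
        case 2
        have "\<forall>\<^sub>F s in at_top. C (snd q) + exp (s powr (snd q)) \<le> exp (m * s powr \<sigma>) / N"
          using \<sigma>q 2 m N by (intro power_exp_dominated) auto
        then show ?thesis
          using eventually_gt_at_top[of 0]
        proof eventually_elim
          case (elim s)
          then show ?case using 2 all[OF \<sigma>q, of s] by (auto simp: T_def intro: order_trans)
        qed
      next
        case 3
        show ?thesis
          using ev eventually_gt_at_top[of 0]
        proof eventually_elim
          case (elim s)
          show ?case
          proof (intro allI impI)
            fix u assume u: "\<bar>u\<bar> \<le> \<delta>"
            have "cos (\<theta> + u - fst q) \<le> cos (pi / (2 * snd q))"
              using \<delta>1(2)[OF _ q 3, of u] u \<delta> by linarith
            then have "norm (T q s u) \<le> C (snd q)" using out[OF \<sigma>q] elim 3 by (simp add: T_def)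
            then show "norm (T q s u) \<le> exp (m * s powr \<sigma>) / N" using elim by linarith
          qed
        qed
      qed
    qed
    then have "\<forall>\<^sub>F s in at_top. \<forall>q\<in>J. \<forall>u. \<bar>u\<bar> \<le> \<delta> \<longrightarrow> norm (T q s u) \<le> exp (m * s powr \<sigma>) / N"
      by (rule eventually_ball_finite[OF J(1)])
    then obtain R where R: "\<And>s q u. s \<ge> R \<Longrightarrow> q \<in> J \<Longrightarrow> \<bar>u\<bar> \<le> \<delta> \<Longrightarrow> norm (T q s u) \<le> exp (m * s powr \<sigma>) / N"
      unfolding eventually_at_top_linorder by blast
    have main: "norm (of_real \<kappa> * S (rcis s (\<theta> + u)) - of_real \<kappa> * exp (X s u)) < \<kappa> / 2 * norm (exp (X s u))"
      if s: "s \<ge> R" and u: "\<bar>u\<bar> \<le> \<delta>" for s u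
    proof -
      have "S (rcis s (\<theta> + u)) - exp (X s u) = (\<Sum>q\<in>J. T q s u)"
        unfolding S_rcis T_def using J p(1) by (simp add: sum_subtractf)
      also have "norm \<dots> \<le> of_nat (card J) * (exp (m * s powr \<sigma>) / N)"
        using R[OF s _ u] by (intro sum_norm_bound) auto
      also have "\<dots> = exp (m * s powr \<sigma>) / 4" using J by (simp add: N_def)
      also have "\<dots> < exp (m * s powr \<sigma>) / 2" by simp
      also have "exp (m * s powr \<sigma>) / 2 \<le> norm (exp (X s u)) / 2"
        using mult_right_mono[OF cosm[OF u], of "s powr \<sigma>"] by (simp add: X_def Re_rcis mult.commute)
      finally have "\<kappa> * norm (S (rcis s (\<theta> + u)) - exp (X s u)) < \<kappa> * (norm (exp (X s u)) / 2)"
        using \<kappa> by (intro mult_strict_left_mono) auto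
      then show ?thesis
        using \<kappa> by (simp add: norm_mult del: norm_exp_eq_Re flip: right_diff_distrib)
    qed
    show "\<exists>\<delta>>0. \<exists>\<psi> R. \<exists>m>0. \<bar>\<psi>\<bar> < pi / (2 * snd p) \<and>
           (\<forall>s\<ge>R. \<forall>u. \<bar>u\<bar> \<le> \<delta> \<longrightarrow> cos (snd p * (\<psi> + u)) \<ge> m \<and>
              norm (of_real \<kappa> * S (rcis s (\<theta> + u)) - of_real \<kappa> * exp (rcis (s powr snd p) (snd p * (\<psi> + u))))
                < \<kappa> / 2 * norm (exp (rcis (s powr snd p) (snd p * (\<psi> + u)))))"
      using \<delta>(1) \<psi>(2) m cosm main unfolding X_def \<sigma>_def by blast
  qed
qed

section \<open>Order of growth\<close>

lemma nevanlinna_characteristic_entire: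
  assumes "f holomorphic_on UNIV"
  shows "nevanlinna_characteristic f r = nevanlinna_proximity f r"
proof -
  have "\<not> is_pole f z" for z
    using not_is_pole_holomorphic[OF open_UNIV _ assms, of z] by simp
  then have "pole_count f t = 0" for t by (simp add: pole_count_def)
  then show ?thesis by (simp add: nevanlinna_characteristic_def nevanlinna_counting_def)
qed

lemma log_plus_eq: "x \<ge> 0 \<Longrightarrow> log_plus x = ln (max x 1)"
proof -
  assume "x \<ge> 0"
  then consider "x = 0" | "0 < x" "x < 1" | "x \<ge> 1" by linarith
  then show ?thesis by cases (simp_all add: log_plus_def max_def)
qed

lemma continuous_on_log_plus_circle:
  assumes "f holomorphic_on UNIV"
  shows "continuous_on A (\<lambda>\<theta>. log_plus (norm (f (rcis r \<theta>))))"
proof -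
  have "continuous_on A (\<lambda>\<theta>. f (rcis r \<theta>))"
    by (rule continuous_on_compose2[OF holomorphic_on_imp_continuous_on[OF assms]])
       (auto simp: rcis_def cis_conv_exp intro!: continuous_intros)
  then show ?thesis
    unfolding log_plus_eq[OF norm_ge_zero] by (intro continuous_intros) auto
qed

lemma nevanlinna_proximity_integral:
  assumes "f holomorphic_on UNIV"
  shows "nevanlinna_proximity f r =
    1 / (2 * pi) * integral {0..2 * pi} (\<lambda>\<theta>. log_plus (norm (f (rcis r \<theta>))))"
  unfolding nevanlinna_proximity_def
  using set_borel_integral_eq_integral(2)[OF borel_integrable_atLeastAtMost'[OF continuous_on_log_plus_circle[OF assms]]]
  by simp

lemma nevanlinna_characteristic_upper:
  assumes hol: "f holomorphic_on UNIV" and A: "A \<ge> 1" "y \<ge> 0"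
    and bound: "\<And>\<phi>. norm (f (rcis r \<phi>)) \<le> A * exp y"
  shows "nevanlinna_characteristic f r \<le> ln A + y"
proof -
  let ?g = "\<lambda>\<theta>. log_plus (norm (f (rcis r \<theta>)))"
  have le: "?g \<theta> \<le> ln A + y" for \<theta>
  proof -
    have "1 * 1 \<le> A * exp y" using A by (intro mult_mono) auto
    then have "?g \<theta> \<le> ln (A * exp y)"
      unfolding log_plus_eq[OF norm_ge_zero] using bound[of \<theta>] A by (subst ln_le_cancel_iff) auto
    also have "\<dots> = ln A + y" using A by (simp add: ln_mult)
    finally show ?thesis .
  qed
  have "integral {0..2 * pi} ?g \<le> integral {0..2 * pi} (\<lambda>_. ln A + y)"
    by (intro integral_le integrable_continuous_real continuous_on_log_plus_circle[OF hol] le) auto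
  then have "integral {0..2 * pi} ?g \<le> 2 * pi * (ln A + y)" by simp
  then have "1 / (2 * pi) * integral {0..2 * pi} ?g \<le> 1 / (2 * pi) * (2 * pi * (ln A + y))"
    by (intro mult_left_mono) auto
  then show ?thesis
    by (simp add: nevanlinna_characteristic_entire[OF hol] nevanlinna_proximity_integral[OF hol])
qed

lemma nevanlinna_characteristic_lower:
  assumes hol: "f holomorphic_on UNIV" and ab: "0 \<le> a" "a \<le> b" "b \<le> 2 * pi"
    and bound: "\<And>\<phi>. a \<le> \<phi> \<Longrightarrow> \<phi> \<le> b \<Longrightarrow> exp y \<le> norm (f (rcis r \<phi>))"
  shows "(b - a) / (2 * pi) * y \<le> nevanlinna_characteristic f r"
proof -
  let ?g = "\<lambda>\<theta>. log_plus (norm (f (rcis r \<theta>)))"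
  have int: "?g integrable_on {u..v}" for u v
    by (intro integrable_continuous_real continuous_on_log_plus_circle[OF hol])
  have ge: "y \<le> ?g \<theta>" if "a \<le> \<theta>" "\<theta> \<le> b" for \<theta>
  proof -
    have "ln (exp y) \<le> ln (norm (f (rcis r \<theta>)))"
      using bound[OF that] by (subst ln_le_cancel_iff) (auto intro: less_le_trans[OF exp_gt_zero])
    then show ?thesis by (simp add: log_plus_def)
  qed
  have "(b - a) * y = integral {a..b} (\<lambda>_. y)" using ab by simp
  also have "\<dots> \<le> integral {a..b} ?g"
    by (intro integral_le int) (use ge in auto)
  also have "\<dots> \<le> integral {0..2 * pi} ?g"
    by (intro integral_subset_le int) (use ab in \<open>auto simp: log_plus_def\<close>)
  finally have "1 / (2 * pi) * ((b - a) * y) \<le> 1 / (2 * pi) * integral {0..2 * pi} ?g"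
    by (intro mult_left_mono) auto
  then show ?thesis
    by (simp add: nevanlinna_characteristic_entire[OF hol] nevanlinna_proximity_integral[OF hol])
qed

text \<open>
  An upper bound on whole circles and a lower bound of the same order on one fixed arc of positive
  length determine the characteristic up to constants.
\<close>

lemma growth_order_eqI:
  assumes hol: "f holomorphic_on UNIV" and \<rho>: "\<rho> > 0"
    and upper: "\<And>s \<phi>. s \<ge> 1 \<Longrightarrow> norm (f (rcis s \<phi>)) \<le> A * exp (s powr \<rho>)"
    and ab: "0 \<le> a" "a < b" "b \<le> 2 * pi" and c: "c > 0"
    and lower: "\<forall>\<^sub>F s in at_top. \<forall>\<phi>. a \<le> \<phi> \<longrightarrow> \<phi> \<le> b \<longrightarrow> exp (c * s powr \<rho>) \<le> norm (f (rcis s \<phi>))"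
  shows "growth_order f = ereal \<rho>"
proof -
  let ?T = "nevanlinna_characteristic f"
  define B where "B = max A 1"
  define d where "d = (b - a) / (2 * pi) * c"
  have d: "d > 0" using ab c by (simp add: d_def)
  have B: "B \<ge> 1" by (simp add: B_def)
  have up: "?T s \<le> ln B + s powr \<rho>" if "s \<ge> 1" for s
  proof (rule nevanlinna_characteristic_upper[OF hol B])
    fix \<phi>
    have "A * exp (s powr \<rho>) \<le> B * exp (s powr \<rho>)" by (intro mult_right_mono) (auto simp: B_def)
    then show "norm (f (rcis s \<phi>)) \<le> B * exp (s powr \<rho>)" using upper[OF that, of \<phi>] by linarith
  qed simp
  have low: "\<forall>\<^sub>F s in at_top. d * s powr \<rho> \<le> ?T s"
    using lower
  proof eventually_elim
    case (elim s)
    then show ?case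
      using nevanlinna_characteristic_lower[OF hol, of a b "c * s powr \<rho>" s] ab by (simp add: d_def)
  qed
  have lim_low: "((\<lambda>s. ln (d * s powr \<rho>) / ln s) \<longlongrightarrow> \<rho>) at_top" using d \<rho> by real_asymp
  have lim_up: "((\<lambda>s. ln (L + s powr \<rho>) / ln s) \<longlongrightarrow> \<rho>) at_top" for L :: real using \<rho> by real_asymp
  have big: "\<forall>\<^sub>F s in at_top. 1 < d * s powr \<rho>" using d \<rho> by real_asymp
  have "((\<lambda>s. log_plus (?T s) / ln s) \<longlongrightarrow> \<rho>) at_top"
  proof (rule tendsto_sandwich[OF _ _ lim_low lim_up[of "ln B"]])
    have ev: "\<forall>\<^sub>F s in at_top. 1 < d * s powr \<rho> \<and> d * s powr \<rho> \<le> ?T s \<and> ?T s \<le> ln B + s powr \<rho> \<and> 0 < ln s"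
      using big low eventually_gt_at_top[of 1] by eventually_elim (use up in auto)
    show "\<forall>\<^sub>F s in at_top. ln (d * s powr \<rho>) / ln s \<le> log_plus (?T s) / ln s"
      using ev by eventually_elim (auto simp: log_plus_def max_def intro!: divide_right_mono)
    show "\<forall>\<^sub>F s in at_top. log_plus (?T s) / ln s \<le> ln (ln B + s powr \<rho>) / ln s"
      using ev by eventually_elim (auto simp: log_plus_def max_def intro!: divide_right_mono)
  qed
  then have "((\<lambda>s. ereal (log_plus (?T s) / ln s)) \<longlongrightarrow> ereal \<rho>) at_top" by simp
  then show ?thesis unfolding growth_order_def by (intro lim_imp_Limsup) auto
qed

section \<open>Intervals of directions\<close>

definition angle_in :: "real \<Rightarrow> real \<Rightarrow> real \<Rightarrow> bool" where
  "angle_in a b t \<longleftrightarrow> (\<exists>k::int. t + 2 * pi * of_int k \<in> {a..b})"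

lemma angle_in_shift: "angle_in a b (t + 2 * pi * of_int k) \<longleftrightarrow> angle_in a b t"
proof -
  have "angle_in a b (t + 2 * pi * of_int k)" if t: "angle_in a b t" for t k
  proof -
    from t obtain j :: int where "t + 2 * pi * of_int j \<in> {a..b}" unfolding angle_in_def by blast
    then have "(t + 2 * pi * of_int k) + 2 * pi * of_int (j - k) \<in> {a..b}" by (simp add: algebra_simps)
    then show ?thesis unfolding angle_in_def by blast
  qed
  from this[of t k] this[of "t + 2 * pi * of_int k" "- k"] show ?thesis by auto
qed

lemma angle_representative:
  obtains k :: int where "t + 2 * pi * of_int k \<in> {0..<2 * pi}"
proof
  define n where "n = \<lfloor>t / (2 * pi)\<rfloor>"
  have "of_int n \<le> t / (2 * pi)" "t / (2 * pi) < of_int n + 1" unfolding n_def by linarith+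
  then show "t + 2 * pi * of_int (- n) \<in> {0..<2 * pi}" by (auto simp: field_simps)
qed

text \<open>
  Intervals longer than the circle are cut down to length \<open>2\<pi>\<close>. If \<open>b - a < 2\<pi>\<close> and \<open>a\<close> is moved into
  \<open>[0, 2\<pi>)\<close>, then the trace on \<open>[0, 2\<pi>)\<close> consists of at most two intervals of total length \<open>b - a\<close>.
\<close>

lemma closed_circle_interval_normal_form:
  assumes "closed_circle_interval S" "x < 2 * pi" "measure lebesgue S \<ge> x"
  obtains a b where "x \<le> b - a" "b - a \<le> 2 * pi" "a \<le> b" "S = {t \<in> {0..<2 * pi}. angle_in a b t}"
proof -
  obtain a0 b0 where ab0: "a0 \<le> b0" "S = {t \<in> {0..<2 * pi}. angle_in a0 b0 t}"
    using assms(1) unfolding closed_circle_interval_def angle_in_def by auto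
  obtain k :: int where k: "a0 + 2 * pi * of_int k \<in> {0..<2 * pi}" by (rule angle_representative)
  define a where "a = a0 + 2 * pi * of_int k"
  define b where "b = min (b0 + 2 * pi * of_int k) (a + 2 * pi)"
  have a: "0 \<le> a" "a < 2 * pi" using k by (auto simp: a_def)
  have ab: "a \<le> b" "b - a \<le> 2 * pi" using ab0(1) by (auto simp: a_def b_def)
  have eq: "angle_in a b t \<longleftrightarrow> angle_in a0 b0 t" for t
  proof -
    have shift: "angle_in a (b0 + 2 * pi * of_int k) t \<longleftrightarrow> angle_in a0 b0 t"
    proof
      assume "angle_in a (b0 + 2 * pi * of_int k) t"
      then obtain j :: int where "t + 2 * pi * of_int j \<in> {a..b0 + 2 * pi * of_int k}" unfolding angle_in_def by blast
      then have "t + 2 * pi * of_int (j - k) \<in> {a0..b0}" by (simp add: a_def algebra_simps)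
      then show "angle_in a0 b0 t" unfolding angle_in_def by blast
    next
      assume "angle_in a0 b0 t"
      then obtain j :: int where "t + 2 * pi * of_int j \<in> {a0..b0}" unfolding angle_in_def by blast
      then have "t + 2 * pi * of_int (j + k) \<in> {a..b0 + 2 * pi * of_int k}" by (simp add: a_def algebra_simps)
      then show "angle_in a (b0 + 2 * pi * of_int k) t" unfolding angle_in_def by blast
    qed
    show ?thesis
    proof (cases "b0 + 2 * pi * of_int k \<le> a + 2 * pi")
      case True
      then show ?thesis using shift by (simp add: b_def)
    next
      case False
      obtain j :: int where "(t - a) + 2 * pi * of_int j \<in> {0..<2 * pi}" by (rule angle_representative)
      then have j: "t + 2 * pi * of_int j \<in> {a..a + 2 * pi}" by auto
      then have "angle_in a b t" unfolding angle_in_def using False by (auto simp: b_def)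
      moreover have "angle_in a (b0 + 2 * pi * of_int k) t"
        unfolding angle_in_def using False j by (intro exI[of _ j]) auto
      ultimately show ?thesis using shift by simp
    qed
  qed
  have S: "S = {t \<in> {0..<2 * pi}. angle_in a b t}" using ab0(2) eq by simp
  have "x \<le> b - a"
  proof (rule ccontr)
    assume "\<not> x \<le> b - a"
    then have less: "b - a < x" by simp
    have "S \<subseteq> {a..min b (2 * pi)} \<union> {0..b - 2 * pi}"
    proof
      fix t assume "t \<in> S"
      then obtain j :: int where t: "0 \<le> t" "t < 2 * pi" and j: "a \<le> t + 2 * pi * of_int j" "t + 2 * pi * of_int j \<le> b"
        unfolding S angle_in_def by auto
      have "2 * pi * of_int j > 2 * pi * (-1)" using t j(1) a by linarith
      then have "of_int j > (-1 :: real)" by (subst (asm) mult_less_cancel_left_pos) auto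
      moreover have "2 * pi * of_int j < 2 * pi * 2" using t j(2) a ab less assms(2) by linarith
      then have "of_int j < (2 :: real)" by (subst (asm) mult_less_cancel_left_pos) auto
      \<comment> \<open>Because \<open>0 \<le> a\<close> and \<open>b < 4\<pi>\<close>, at most one turn has to be added.\<close>
      ultimately have "j = 0 \<or> j = 1" by linarith
      then show "t \<in> {a..min b (2 * pi)} \<union> {0..b - 2 * pi}" using t j by auto
    qed
    then have "measure lebesgue S \<le> measure lebesgue ({a..min b (2 * pi)} \<union> {0..b - 2 * pi})"
    proof (rule measure_mono_fmeasurable)
      have "S = {0..<2 * pi} \<inter> (\<Union>j::int. {a - 2 * pi * of_int j..b - 2 * pi * of_int j})"
        by (auto simp: S angle_in_def algebra_simps)
      then show "S \<in> sets lebesgue" by (auto intro!: sets.Int sets.countable_UN'')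
    qed auto
    also have "\<dots> \<le> measure lebesgue {a..min b (2 * pi)} + measure lebesgue {0..b - 2 * pi}"
      by (intro measure_Un_le) auto
    also have "\<dots> \<le> b - a" using ab a less assms(2) by (auto simp: min_def)
    finally show False using less assms(3) by linarith
  qed
  then show ?thesis using that[OF _ ab(2,1) S] by blast
qed

text \<open>
  The length of the second sector of an interval of length \<open>l\<close>. It can be \<open>l\<close> itself unless \<open>l = 2\<pi>\<close>,
  which would force the inadmissible order \<open>1/2\<close>; in that case a length \<open>l' < 2\<pi>\<close> is chosen
  with which the two sectors still cover the interval.
\<close>

lemma inner_arc_length:
  fixes x l :: real
  assumes "0 < x" "x < 2 * pi" "x \<le> l" "l \<le> 2 * pi"
  obtains l' where "x \<le> l'" "l' < 2 * pi" "l' \<le> l" "l - x \<le> l'" "l' = x \<longrightarrow> l = x"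
proof (cases "l < 2 * pi")
  case True
  then show ?thesis using assms by (intro that[of l]) auto
next
  case False
  then show ?thesis using assms
    by (intro that[of "(max x (2 * pi - x) + 2 * pi) / 2"]) (auto simp: max_def)
qed

lemma cos_less_cos_far:
  assumes "0 \<le> d" "d < \<bar>\<psi>\<bar>" "\<bar>\<psi>\<bar> < 2 * pi - d"
  shows "cos \<psi> < cos d"
proof -
  define e where "e = min \<bar>\<psi>\<bar> (2 * pi - \<bar>\<psi>\<bar>)"
  have e: "d < e" "e \<le> pi" using assms by (auto simp: e_def)
  have "cos \<psi> \<le> cos e" using e assms by (intro cos_le_cos_far) (auto simp: e_def)
  also have "cos e < cos d" using e assms by (intro cos_monotone_0_pi) auto
  finally show ?thesis .
qed

lemma cos_greater_cos_near:
  assumes "\<bar>\<psi>\<bar> < d" "d \<le> pi"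
  shows "cos d < cos \<psi>"
  using cos_monotone_0_pi[of "\<bar>\<psi>\<bar>" d] assms by simp

lemma dominates_shift: "dominates J p (t + 2 * pi * of_int k) \<longleftrightarrow> dominates J p t"
proof -
  have "cos (t + 2 * pi * of_int k - c) = cos (t - c)" for c
    using cos_shift[of "t - c" k] by (simp add: algebra_simps)
  then show ?thesis by (simp add: dominates_def)
qed

lemma exists_near_avoiding:
  fixes a b t v \<delta> :: real
  assumes "a < b" "a \<le> t" "t \<le> b" "\<delta> > 0"
  obtains t' where "a < t'" "t' < b" "t' \<noteq> v" "\<bar>t' - t\<bar> < \<delta>"
proof -
  define lo hi where "lo = max a (t - \<delta>)" and "hi = min b (t + \<delta>)"
  have lh: "lo < hi" "a \<le> lo" "t - \<delta> \<le> lo" "hi \<le> b" "hi \<le> t + \<delta>"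
    using assms by (auto simp: lo_def hi_def)
  have found: thesis if "lo < w" "w < hi" "w \<noteq> v" for w
    by (rule \<open>\<And>t'. a < t' \<Longrightarrow> t' < b \<Longrightarrow> t' \<noteq> v \<Longrightarrow> \<bar>t' - t\<bar> < \<delta> \<Longrightarrow> thesis\<close>[of w])
       (use that lh in linarith)+
  \<comment> \<open>One of two distinct points of the open interval differs from \<open>v\<close>.\<close>
  have "(2 * lo + hi) / 3 \<noteq> (lo + 2 * hi) / 3" using lh by simp
  then consider "(2 * lo + hi) / 3 \<noteq> v" | "(lo + 2 * hi) / 3 \<noteq> v" by metis
  then show thesis
  proof cases
    case 1
    then show thesis using lh by (intro found[of "(2 * lo + hi) / 3"]) auto
  next
    case 2
    then show thesis using lh by (intro found[of "(lo + 2 * hi) / 3"]) auto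
  qed
qed

text \<open>
  With \<open>x = \<pi>/\<rho>\<close>, the interval \<open>[a i, b i]\<close> receives the sector \<open>p i\<close> over \<open>[a i, a i + x]\<close>, of order \<open>\<rho>\<close>, and
  the sector \<open>q i\<close> over \<open>[b i - l i, b i]\<close>, of order \<open>\<pi> / l i\<close>. Both coincide if \<open>l i = x\<close>; otherwise the order of
  \<open>q i\<close> is smaller. So \<open>p i\<close> dominates in its interior, and \<open>q i\<close> dominates the rest of the interval. No
  sector reaches beyond its interval, and the direction \<open>a i0\<close> is on the boundary or outside of every
  sector, even when the interval is the full circle.
\<close>

lemma exponential_arc_system:
  fixes a b :: "'i \<Rightarrow> real"
  assumes K: "finite K" "i0 \<in> K" and \<rho>: "\<rho> > 1 / 2"
    and len: "\<And>i. i \<in> K \<Longrightarrow> pi / \<rho> \<le> b i - a i" "\<And>i. i \<in> K \<Longrightarrow> b i - a i \<le> 2 * pi"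
    and disj: "\<And>i j t. i \<in> K \<Longrightarrow> j \<in> K \<Longrightarrow> angle_in (a i) (b i) t \<Longrightarrow> angle_in (a j) (b j) t \<Longrightarrow> i = j"
  obtains J \<alpha> where "finite J" "J \<noteq> {}" "\<And>p. p \<in> J \<Longrightarrow> snd p > 1 / 2 \<and> snd p \<le> \<rho>"
    and "\<forall>p\<in>J. cos (\<alpha> - fst p) \<le> cos (pi / (2 * snd p))"
    and "\<And>t p. \<forall>i\<in>K. \<not> angle_in (a i) (b i) t \<Longrightarrow> p \<in> J \<Longrightarrow>
           cos (t - fst p) < cos (pi / (2 * snd p))"
    and "\<And>i t \<delta>. i \<in> K \<Longrightarrow> a i \<le> t \<Longrightarrow> t \<le> b i \<Longrightarrow> \<delta> > 0 \<Longrightarrow>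
           \<exists>t' p. \<bar>t' - t\<bar> < \<delta> \<and> dominates J p t'"
    and "\<exists>t p. dominates J p t \<and> snd p = \<rho>"
proof -
  define x where "x = pi / \<rho>"
  have x: "0 < x" "x < 2 * pi" using \<rho> by (auto simp: x_def field_simps)
  have x_half: "pi / (2 * \<rho>) = x / 2" and x_inv: "pi / x = \<rho>" using \<rho> by (auto simp: x_def)
  have "\<exists>l'. x \<le> l' \<and> l' < 2 * pi \<and> l' \<le> b i - a i \<and> b i - a i - x \<le> l' \<and> (l' = x \<longrightarrow> b i - a i = x)"
    if "i \<in> K" for i
    using inner_arc_length[OF x, of "b i - a i"] len[OF that] unfolding x_def by metis
  then obtain l where l: "\<And>i. i \<in> K \<Longrightarrow> x \<le> l i \<and> l i < 2 * pi \<and> l i \<le> b i - a i \<and>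
     b i - a i - x \<le> l i \<and> (l i = x \<longrightarrow> b i - a i = x)"
    by metis
  define p where "p = (\<lambda>i. (a i + x / 2, \<rho>))"
  define q where "q = (\<lambda>i. (b i - l i / 2, pi / l i))"
  define J where "J = p ` K \<union> q ` K"
  have p_half: "pi / (2 * snd (p i)) = x / 2" and p_fst: "fst (p i) = a i + x / 2" for i
    using x_half by (simp_all add: p_def)
  have q_half: "pi / (2 * snd (q i)) = l i / 2" and q_fst: "fst (q i) = b i - l i / 2" for i
    by (simp_all add: q_def)
  have inside: "0 < pi / (2 * snd r) \<and> pi / (2 * snd r) < pi \<and> a i \<le> fst r - pi / (2 * snd r) \<and>
      fst r + pi / (2 * snd r) \<le> b i"
    if "i \<in> K" "r = p i \<or> r = q i" for i r
    using that(2)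
  proof
    assume "r = p i"
    then show ?thesis using x len[OF that(1)] by (simp add: p_half p_fst x_def[symmetric])
  next
    assume "r = q i"
    then show ?thesis using l[OF that(1)] x by (simp add: q_half q_fst)
  qed
  have outside: "cos (t - fst r) < cos (pi / (2 * snd r))"
    if i: "i \<in> K" "r = p i \<or> r = q i" and n: "\<not> angle_in (a i) (b i) t" for i r t
  proof (rule ccontr)
    note ins = inside[OF i]
    assume "\<not> cos (t - fst r) < cos (pi / (2 * snd r))"
    then obtain k :: int where "\<bar>(t - fst r) + 2 * pi * of_int k\<bar> \<le> pi / (2 * snd r)"
      using cos_ge_imp_near[of "pi / (2 * snd r)" "t - fst r"] ins by force
    then have "t + 2 * pi * of_int k \<in> {a i..b i}" using ins by auto
    then show False using n unfolding angle_in_def by blast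
  qed
  have other: "cos (t - fst r) < cos (pi / (2 * snd r))"
    if "i \<in> K" "j \<in> K" "i \<noteq> j" "r = p j \<or> r = q j" "a i \<le> t" "t \<le> b i" for i j r t
  proof (rule outside[OF that(2,4)])
    have "angle_in (a i) (b i) t" unfolding angle_in_def using that by (intro exI[of _ 0]) auto
    then show "\<not> angle_in (a j) (b j) t" using disj[OF that(1,2), of t] that(3) by blast
  qed
  have dom_p: "dominates J (p i) t" if i: "i \<in> K" and t: "a i < t" "t < a i + x" for i t
    unfolding dominates_def
  proof (intro conjI ballI)
    show "p i \<in> J" using i by (simp add: J_def)
    show "cos (pi / (2 * snd (p i))) < cos (t - fst (p i))"
      unfolding p_half p_fst using t x by (intro cos_greater_cos_near) linarith+
    have tb: "t \<le> b i" using t len(1)[OF i] by (simp add: x_def)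
    fix r assume "r \<in> J - {p i}"
    then obtain j where j: "j \<in> K" "r = p j \<or> r = q j" "r \<noteq> p i" by (auto simp: J_def)
    show "snd r < snd (p i) \<or> cos (t - fst r) < cos (pi / (2 * snd r))"
    proof (cases "j = i")
      case True
      then have r: "r = q i" using j by auto
      have "l i \<noteq> x"
      proof
        assume "l i = x"
        then have "q i = p i" using l[OF i] x_inv by (simp add: p_def q_def)
        then show False using r j by simp
      qed
      then have "x < l i" using l[OF i] by simp
      then have "pi / l i < pi / x" using x by (intro divide_strict_left_mono) auto
      then show ?thesis unfolding r by (simp add: p_def q_def x_inv)
    next
      case False
      then show ?thesis using other[OF i j(1) _ j(2)] t tb by simp
    qed
  qed
  have dom_q: "dominates J (q i) t" if i: "i \<in> K" and t: "a i + x < t" "t < b i" for i t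
    unfolding dominates_def
  proof (intro conjI ballI)
    have li: "l i < 2 * pi" "b i - a i - x \<le> l i" using l[OF i] by blast+
    show "q i \<in> J" using i by (simp add: J_def)
    show "cos (pi / (2 * snd (q i))) < cos (t - fst (q i))"
      unfolding q_half q_fst using t li x by (intro cos_greater_cos_near) linarith+
    fix r assume "r \<in> J - {q i}"
    then obtain j where j: "j \<in> K" "r = p j \<or> r = q j" "r \<noteq> q i" by (auto simp: J_def)
    show "snd r < snd (q i) \<or> cos (t - fst r) < cos (pi / (2 * snd r))"
    proof (cases "j = i")
      case True
      then have r: "r = p i" using j by auto
      have "cos (t - (a i + x / 2)) < cos (x / 2)"
        using t x len(2)[OF i] by (intro cos_less_cos_far) auto
      then show ?thesis unfolding r p_half p_fst by simp
    next
      case False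
      then show ?thesis using other[OF i j(1) _ j(2)] t x by simp
    qed
  qed
  show ?thesis
  proof (rule that[of J "a i0"])
    show "finite J" "J \<noteq> {}" using K by (auto simp: J_def)
    show "snd r > 1 / 2 \<and> snd r \<le> \<rho>" if "r \<in> J" for r
      using that unfolding J_def
    proof
      assume "r \<in> p ` K"
      then show ?thesis using \<rho> by (auto simp: p_def)
    next
      assume "r \<in> q ` K"
      then obtain i where i: "i \<in> K" "r = q i" by blast
      have "pi / (2 * pi) < pi / l i" using l[OF i(1)] x by (intro divide_strict_left_mono) auto
      moreover have "pi / l i \<le> pi / x" using l[OF i(1)] x by (intro divide_left_mono) auto
      ultimately show ?thesis using i x_inv by (simp add: q_def)
    qed
    show "\<forall>r\<in>J. cos (a i0 - fst r) \<le> cos (pi / (2 * snd r))"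
    proof
      fix r assume "r \<in> J"
      then obtain j where j: "j \<in> K" "r = p j \<or> r = q j" by (auto simp: J_def)
      show "cos (a i0 - fst r) \<le> cos (pi / (2 * snd r))"
      proof (cases "j = i0")
        case True
        have "a i0 \<le> fst r - pi / (2 * snd r)" "fst r + pi / (2 * snd r) \<le> b i0" "0 < pi / (2 * snd r)"
          using inside[OF j] True by auto
        then show ?thesis using len(2)[OF K(2)] by (intro cos_le_cos_far) linarith+
      next
        case False
        have "a i0 \<le> b i0" using len(1)[OF K(2)] x by (simp add: x_def[symmetric])
        then show ?thesis using other[OF K(2) j(1) _ j(2), of "a i0"] False by simp
      qed
    qed
    show "cos (t - fst r) < cos (pi / (2 * snd r))"
      if n: "\<forall>i\<in>K. \<not> angle_in (a i) (b i) t" and r: "r \<in> J" for t r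
    proof -
      from r obtain j where j: "j \<in> K" "r = p j \<or> r = q j" by (auto simp: J_def)
      show ?thesis by (rule outside[OF j bspec[OF n j(1)]])
    qed
    show "\<exists>t' r. \<bar>t' - t\<bar> < \<delta> \<and> dominates J r t'"
      if i: "i \<in> K" and t: "a i \<le> t" "t \<le> b i" and \<delta>: "\<delta> > 0" for i t \<delta>
    proof -
      have "a i < b i" using len(1)[OF i] x by (simp add: x_def[symmetric])
      then obtain t' where t': "a i < t'" "t' < b i" "t' \<noteq> a i + x" "\<bar>t' - t\<bar> < \<delta>"
        using exists_near_avoiding[OF _ t \<delta>, of "a i + x"] by blast
      show ?thesis
      proof (cases "t' < a i + x")
        case True
        then show ?thesis using dom_p[OF i t'(1)] t'(4) by blast
      next
        case False
        then show ?thesis using dom_q[OF i _ t'(2)] t' by fastforce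
      qed
    qed
    have "dominates J (p i0) (a i0 + x / 2)" using x by (intro dom_p K(2)) auto
    then show "\<exists>t r. dominates J r t \<and> snd r = \<rho>" by (intro exI[of _ "a i0 + x / 2"] exI[of _ "p i0"]) (simp add: p_def)
  qed
qed

section \<open>Julia limiting directions of the superposition\<close>

lemma julia_limiting_directionI:
  assumes \<theta>: "\<theta> \<in> {0..<2 * pi}"
    and ex: "\<And>n :: nat. \<exists>s \<phi>. s \<ge> real n \<and> \<bar>\<phi> - \<theta>\<bar> \<le> 1 / real (Suc n) \<and> rcis s \<phi> \<in> julia_set f"
  shows "\<theta> \<in> julia_limiting_directions f"
proof -
  obtain s \<phi> where s: "\<And>n. s n \<ge> real n" and \<phi>: "\<And>n. \<bar>\<phi> n - \<theta>\<bar> \<le> 1 / real (Suc n)"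
    and J: "\<And>n. rcis (s n) (\<phi> n) \<in> julia_set f"
    using ex by metis
  have s0: "s n \<ge> 0" for n using s[of n] by simp
  have "\<not> bounded (range (\<lambda>n. rcis (s n) (\<phi> n)))"
  proof
    assume "bounded (range (\<lambda>n. rcis (s n) (\<phi> n)))"
    then obtain B where "\<And>n. norm (rcis (s n) (\<phi> n)) \<le> B" by (auto simp: bounded_iff)
    then have "s n \<le> B" for n using s0[of n] by (metis abs_of_nonneg complex_mod_rcis)
    then have "real n \<le> B" for n using s[of n] by (meson order_trans)
    then show False using reals_Archimedean2[of B] by (meson not_le)
  qed
  moreover have "is_Arg (rcis (s n) (\<phi> n)) (\<phi> n)" for n
    using s0[of n] by (simp add: is_Arg_def rcis_def cis_conv_exp norm_mult)
  moreover have "\<phi> \<longlonglongrightarrow> \<theta>"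
  proof (rule LIM_zero_cancel)
    show "(\<lambda>n. \<phi> n - \<theta>) \<longlonglongrightarrow> 0"
      by (rule Lim_null_comparison[OF _ LIMSEQ_Suc[OF lim_1_over_n]]) (use \<phi> in auto)
  qed
  ultimately show ?thesis
    unfolding julia_limiting_directions_def using \<theta> J
    by (intro CollectI conjI exI[of _ "\<lambda>n. rcis (s n) (\<phi> n)"] exI[of _ \<phi>]) auto
qed

theorem theorem2:
  fixes \<rho> :: real and m :: nat and I :: "nat \<Rightarrow> real set"
  assumes "\<rho> > 1 / 2"
    and "m \<ge> 1"
    and "real m \<le> 2 * \<rho>"
    and "\<And>i. i \<in> {1..m} \<Longrightarrow> closed_circle_interval (I i)"
    and "disjoint_family_on I {1..m}"
    and "\<And>i. i \<in> {1..m} \<Longrightarrow> measure lebesgue (I i) \<ge> pi / \<rho>"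
  shows "\<exists>f :: complex \<Rightarrow> complex. f holomorphic_on UNIV \<and> growth_order f = ereal \<rho> \<and>
           julia_limiting_directions f = (\<Union>i\<in>{1..m}. I i)"
proof -
  have x: "pi / \<rho> < 2 * pi" using assms(1) by (simp add: field_simps)
  have "\<forall>i\<in>{1..m}. \<exists>c. pi / \<rho> \<le> snd c - fst c \<and> snd c - fst c \<le> 2 * pi \<and>
      I i = {t \<in> {0..<2 * pi}. angle_in (fst c) (snd c) t}"
  proof
    fix i assume i: "i \<in> {1..m}"
    obtain a b where "pi / \<rho> \<le> b - a" "b - a \<le> 2 * pi" "I i = {t \<in> {0..<2 * pi}. angle_in a b t}"
      by (rule closed_circle_interval_normal_form[OF assms(4)[OF i] x assms(6)[OF i]])
    then show "\<exists>c. pi / \<rho> \<le> snd c - fst c \<and> snd c - fst c \<le> 2 * pi \<and>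
      I i = {t \<in> {0..<2 * pi}. angle_in (fst c) (snd c) t}" by (intro exI[of _ "(a, b)"]) simp
  qed
  then obtain c where c: "\<forall>i\<in>{1..m}. pi / \<rho> \<le> snd (c i) - fst (c i) \<and> snd (c i) - fst (c i) \<le> 2 * pi \<and>
      I i = {t \<in> {0..<2 * pi}. angle_in (fst (c i)) (snd (c i)) t}"
    by (rule bchoice[THEN exE])
  define a b where "a = (\<lambda>i. fst (c i))" and "b = (\<lambda>i. snd (c i))"
  have len: "pi / \<rho> \<le> b i - a i" "b i - a i \<le> 2 * pi"
    and I: "I i = {t \<in> {0..<2 * pi}. angle_in (a i) (b i) t}" if "i \<in> {1..m}" for i
    using bspec[OF c that] by (simp_all add: a_def b_def)
  have disj: "i = j" if "i \<in> {1..m}" "j \<in> {1..m}" "angle_in (a i) (b i) t" "angle_in (a j) (b j) t" for i j t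
  proof (rule ccontr)
    assume "i \<noteq> j"
    then have "I i \<inter> I j = {}" using assms(5) that(1,2) by (auto simp: disjoint_family_on_def)
    moreover obtain k :: int where "t + 2 * pi * of_int k \<in> {0..<2 * pi}" by (rule angle_representative)
    then have "t + 2 * pi * of_int k \<in> I i \<inter> I j" using that I by (simp add: angle_in_shift)
    ultimately show False by blast
  qed
  have "1 \<in> {1..m}" using assms(2) by simp
  obtain J \<alpha> where J: "finite J" "J \<noteq> {}" "\<And>p. p \<in> J \<Longrightarrow> snd p > 1 / 2 \<and> snd p \<le> \<rho>"
    and quiet: "\<forall>p\<in>J. cos (\<alpha> - fst p) \<le> cos (pi / (2 * snd p))"
    and outside: "\<And>t p. \<forall>i\<in>{1..m}. \<not> angle_in (a i) (b i) t \<Longrightarrow> p \<in> J \<Longrightarrow>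
           cos (t - fst p) < cos (pi / (2 * snd p))"
    and dense: "\<And>i t \<delta>. i \<in> {1..m} \<Longrightarrow> a i \<le> t \<Longrightarrow> t \<le> b i \<Longrightarrow> \<delta> > 0 \<Longrightarrow>
           \<exists>t' p. \<bar>t' - t\<bar> < \<delta> \<and> dominates J p t'"
    and top: "\<exists>t p. dominates J p t \<and> snd p = \<rho>"
    by (rule exponential_arc_system[OF finite_atLeastAtMost \<open>1 \<in> {1..m}\<close> assms(1) len disj])
       (assumption | rule that)+
  obtain f :: "complex \<Rightarrow> complex" and \<kappa> A :: real where hol: "f holomorphic_on UNIV" and \<kappa>: "\<kappa> > 0"
    and trap: "\<And>z. norm z \<le> 1 \<Longrightarrow> norm (f z) \<le> 1 / 2"
    and small: "\<And>s \<phi>. s > 0 \<Longrightarrow> \<forall>p\<in>J. cos (\<phi> - fst p) \<le> cos (pi / (2 * snd p)) \<Longrightarrow>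
           norm (f (rcis s \<phi>)) \<le> 1 / 2"
    and upper: "\<And>s \<phi>. s \<ge> 1 \<Longrightarrow> norm (f (rcis s \<phi>)) \<le> A * exp (s powr \<rho>)"
    and dom: "\<And>p \<theta>. dominates J p \<theta> \<Longrightarrow> \<exists>\<delta>>0. \<exists>\<psi> R. \<exists>m>0. \<bar>\<psi>\<bar> < pi / (2 * snd p) \<and>
           (\<forall>s\<ge>R. \<forall>u. \<bar>u\<bar> \<le> \<delta> \<longrightarrow> cos (snd p * (\<psi> + u)) \<ge> m \<and>
              norm (f (rcis s (\<theta> + u)) - of_real \<kappa> * exp (rcis (s powr snd p) (snd p * (\<psi> + u))))
                < \<kappa> / 2 * norm (exp (rcis (s powr snd p) (snd p * (\<psi> + u)))))"
    by (rule superposition_exists[OF J]) (assumption | rule that)+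
  have julia_near: "\<exists>s u. s \<ge> R0 \<and> \<bar>u\<bar> \<le> \<epsilon> \<and> rcis s (\<theta> + u) \<in> julia_set f"
    if d: "dominates J p \<theta>" and \<epsilon>: "\<epsilon> > 0" for p \<theta> \<epsilon> R0
  proof -
    have "p \<in> J" using d by (simp add: dominates_def)
    then have p: "snd p > 0" using J(3)[of p] by linarith
    obtain \<delta> \<psi> R c where \<delta>: "\<delta> > 0" and \<psi>: "\<bar>\<psi>\<bar> < pi / (2 * snd p)"
      and approx: "\<And>s u. s \<ge> R \<Longrightarrow> \<bar>u\<bar> \<le> \<delta> \<Longrightarrow>
         norm (f (rcis s (\<theta> + u)) - of_real \<kappa> * exp (rcis (s powr snd p) (snd p * (\<psi> + u))))
                < \<kappa> / 2 * norm (exp (rcis (s powr snd p) (snd p * (\<psi> + u))))"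
      using dom[OF d] by blast
    have "\<forall>\<^sub>F r in at_top. \<exists>r'\<ge>r. \<forall>w. r' \<le> norm w \<and> norm w \<le> 2 * r' \<longrightarrow>
        w \<in> f ` sector_box \<theta> (min \<delta> \<epsilon>) r"
      by (rule exponential_sector_covers_annuli[OF holomorphic_on_imp_continuous_on[OF hol] p \<kappa> _ \<psi>])
         (use \<delta> \<epsilon> approx in auto)
    then obtain s u where "s \<ge> R0" "\<bar>u\<bar> \<le> min \<delta> \<epsilon>" "rcis s (\<theta> + u) \<in> julia_set f"
      using covering_sector_contains_julia_points[OF hol trap small[OF _ quiet], of "min \<delta> \<epsilon>" \<theta> R0] \<delta> \<epsilon>
      by auto
    then show ?thesis by auto
  qed
  have "growth_order f = ereal \<rho>"
  proof -
    obtain t p where tp: "dominates J p t" "snd p = \<rho>" using top by blast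
    obtain k :: int where k: "t + 2 * pi * of_int k \<in> {0..<2 * pi}" by (rule angle_representative)
    define \<theta> where "\<theta> = t + 2 * pi * of_int k"
    have \<theta>: "0 \<le> \<theta>" "\<theta> < 2 * pi" "dominates J p \<theta>"
      using k tp(1) by (auto simp: \<theta>_def dominates_shift)
    obtain \<delta> \<psi> R c where \<delta>: "\<delta> > 0" and c: "c > 0"
      and approx: "\<And>s u. s \<ge> R \<Longrightarrow> \<bar>u\<bar> \<le> \<delta> \<Longrightarrow> cos (\<rho> * (\<psi> + u)) \<ge> c \<and>
         norm (f (rcis s (\<theta> + u)) - of_real \<kappa> * exp (rcis (s powr \<rho>) (\<rho> * (\<psi> + u))))
                < \<kappa> / 2 * norm (exp (rcis (s powr \<rho>) (\<rho> * (\<psi> + u))))"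
      using dom[OF \<theta>(3)] unfolding tp(2) by blast
    have \<rho>0: "\<rho> > 0" using assms(1) by simp
    have ev: "\<forall>\<^sub>F s in at_top. exp (c / 2 * s powr \<rho>) \<le> \<kappa> / 2 * exp (c * s powr \<rho>)"
      using c \<kappa> \<rho>0 by real_asymp
    \<comment> \<open>The circle means are taken over \<open>[0, 2\<pi>]\<close>, so the arc on which \<open>f\<close> is large must not leave this
      interval; as \<open>\<theta> < 2\<pi>\<close>, a piece to the right of \<open>\<theta>\<close> remains.\<close>
    show ?thesis
    proof (rule growth_order_eqI[OF hol \<rho>0 upper \<theta>(1), where b = "min (\<theta> + \<delta>) (2 * pi)" and c = "c / 2"])
      show "\<forall>\<^sub>F s in at_top. \<forall>\<phi>. \<theta> \<le> \<phi> \<longrightarrow> \<phi> \<le> min (\<theta> + \<delta>) (2 * pi) \<longrightarrow>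
              exp (c / 2 * s powr \<rho>) \<le> norm (f (rcis s \<phi>))"
        using ev eventually_ge_at_top[of R]
      proof eventually_elim
        case (elim s)
        show ?case
        proof (intro allI impI)
          fix \<phi> assume \<phi>: "\<theta> \<le> \<phi>" "\<phi> \<le> min (\<theta> + \<delta>) (2 * pi)"
          define X where "X = rcis (s powr \<rho>) (\<rho> * (\<psi> + (\<phi> - \<theta>)))"
          have "\<bar>\<phi> - \<theta>\<bar> \<le> \<delta>" using \<phi> by auto
          note ap = approx[OF elim(2) this]
          have "norm (f (rcis s \<phi>) - of_real \<kappa> * exp X) < \<kappa> / 2 * norm (exp X)"
            using ap by (simp add: X_def)
          moreover have "norm (of_real \<kappa> * exp X) \<le> norm (f (rcis s \<phi>) - of_real \<kappa> * exp X) + norm (f (rcis s \<phi>))"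
            by (metis norm_minus_commute norm_triangle_sub add.commute)
          moreover have "norm (of_real \<kappa> * exp X) = \<kappa> * norm (exp X)" using \<kappa> by (simp add: norm_mult)
          ultimately have "\<kappa> / 2 * norm (exp X) \<le> norm (f (rcis s \<phi>))" by linarith
          moreover have "exp (c * s powr \<rho>) \<le> norm (exp X)"
            using mult_right_mono[OF conjunct1[OF ap], of "s powr \<rho>"] by (simp add: X_def Re_rcis mult.commute)
          then have "\<kappa> / 2 * exp (c * s powr \<rho>) \<le> \<kappa> / 2 * norm (exp X)"
            using \<kappa> by (intro mult_left_mono) auto
          ultimately show "exp (c / 2 * s powr \<rho>) \<le> norm (f (rcis s \<phi>))" using elim(1) by linarith
        qed
      qed
    qed (use \<theta> \<delta> c in auto)
  qed
  moreover have "julia_limiting_directions f = (\<Union>i\<in>{1..m}. I i)"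
  proof (intro equalityI subsetI)
    fix \<theta> assume "\<theta> \<in> (\<Union>i\<in>{1..m}. I i)"
    then obtain i where i: "i \<in> {1..m}" "\<theta> \<in> I i" by blast
    then have \<theta>: "\<theta> \<in> {0..<2 * pi}" "angle_in (a i) (b i) \<theta>" using I by auto
    then obtain k :: int where k: "a i \<le> \<theta> + 2 * pi * of_int k" "\<theta> + 2 * pi * of_int k \<le> b i"
      unfolding angle_in_def by auto
    show "\<theta> \<in> julia_limiting_directions f"
    proof (rule julia_limiting_directionI[OF \<theta>(1)])
      fix n :: nat
      define \<epsilon> where "\<epsilon> = 1 / real (Suc n) / 2"
      have \<epsilon>: "\<epsilon> > 0" by (simp add: \<epsilon>_def)
      have halves: "\<epsilon> + \<epsilon> = 1 / real (Suc n)" unfolding \<epsilon>_def by (rule field_sum_of_halves)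
      obtain t' p where t': "\<bar>t' - (\<theta> + 2 * pi * of_int k)\<bar> < \<epsilon>" "dominates J p t'"
        using dense[OF i(1) k \<epsilon>] by blast
      obtain s u where su: "s \<ge> real n" "\<bar>u\<bar> \<le> \<epsilon>" "rcis s (t' + u) \<in> julia_set f"
        using julia_near[OF t'(2) \<epsilon>] by blast
      have "rcis s (t' + u - 2 * pi * of_int k) \<in> julia_set f"
        using su(3) rcis_shift[of s "t' + u - 2 * pi * of_int k" k] by simp
      moreover have "\<bar>(t' + u - 2 * pi * of_int k) - \<theta>\<bar> \<le> 1 / real (Suc n)"
        using t'(1) su(2) halves by linarith
      ultimately show "\<exists>s \<phi>. s \<ge> real n \<and> \<bar>\<phi> - \<theta>\<bar> \<le> 1 / real (Suc n) \<and> rcis s \<phi> \<in> julia_set f"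
        using su(1) by blast
    qed
  next
    fix \<theta> assume "\<theta> \<in> julia_limiting_directions f"
    then obtain z \<phi> where \<theta>: "\<theta> \<in> {0..<2 * pi}" and z: "\<And>n. z n \<in> julia_set f"
      and arg: "\<And>n. is_Arg (z n) (\<phi> n)" and lim: "\<phi> \<longlonglongrightarrow> \<theta>"
      unfolding julia_limiting_directions_def by blast
    show "\<theta> \<in> (\<Union>i\<in>{1..m}. I i)"
    proof (rule ccontr)
      assume "\<theta> \<notin> (\<Union>i\<in>{1..m}. I i)"
      then have out: "cos (\<theta> - fst p) < cos (pi / (2 * snd p))" if "p \<in> J" for p
        using outside[OF _ that, of \<theta>] I \<theta> by blast
      \<comment> \<open>The points whose direction is strictly outside all sectors. The inequality is homogeneous in \<open>w\<close>,
        so no choice of an argument is involved and \<open>W\<close> is visibly open; it excludes \<open>w = 0\<close>.\<close>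
      define W where "W = (\<Inter>p\<in>J. {w. Re (w * cis (- fst p)) < norm w * cos (pi / (2 * snd p))})"
      have "open W" unfolding W_def
        by (intro open_INT J(1) ballI open_Collect_less continuous_intros)
      moreover have "norm (f w) \<le> 1 / 2" if "w \<in> W" for w
      proof -
        have w: "w = rcis (norm w) (Arg w)" by (simp add: rcis_cmod_Arg)
        have "w \<noteq> 0" using that J(2) by (auto simp: W_def)
        then have pos: "norm w > 0" by simp
        have "norm (f (rcis (norm w) (Arg w))) \<le> 1 / 2"
        proof (rule small[OF pos ballI])
          fix p assume "p \<in> J"
          then have "Re (rcis (norm w) (Arg w) * cis (- fst p)) < norm w * cos (pi / (2 * snd p))"
            using that w by (auto simp: W_def)
          also have "rcis (norm w) (Arg w) * cis (- fst p) = rcis (norm w) (Arg w - fst p)"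
            by (simp add: rcis_def cis_mult mult.assoc)
          finally show "cos (Arg w - fst p) \<le> cos (pi / (2 * snd p))"
            using pos by (simp add: Re_rcis)
        qed
        then show ?thesis using w by simp
      qed
      ultimately have W: "W \<subseteq> fatou_set f" by (intro fatou_set_if_trapped[OF hol trap])
      have disc: "ball 0 1 \<subseteq> fatou_set f"
        by (rule fatou_set_if_trapped[OF hol trap open_ball]) (assumption, rule trap, simp)
      have "\<forall>p\<in>J. \<forall>\<^sub>F n in sequentially. cos (\<phi> n - fst p) < cos (pi / (2 * snd p))"
      proof
        fix p assume "p \<in> J"
        show "\<forall>\<^sub>F n in sequentially. cos (\<phi> n - fst p) < cos (pi / (2 * snd p))"
          by (rule order_tendstoD(2)[OF _ out[OF \<open>p \<in> J\<close>]]) (intro tendsto_intros lim)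
      qed
      then have "\<forall>\<^sub>F n in sequentially. \<forall>p\<in>J. cos (\<phi> n - fst p) < cos (pi / (2 * snd p))"
        by (rule eventually_ball_finite[OF J(1)])
      then obtain n where n: "\<And>p. p \<in> J \<Longrightarrow> cos (\<phi> n - fst p) < cos (pi / (2 * snd p))"
        by (auto simp: eventually_sequentially)
      have zn: "z n = rcis (norm (z n)) (\<phi> n)"
        using arg[of n] by (simp add: is_Arg_def rcis_def cis_conv_exp)
      have "z n \<in> fatou_set f"
      proof (cases "z n = 0")
        case True
        then show ?thesis using disc by auto
      next
        case False
        have "z n \<in> W" unfolding W_def
        proof (intro INT_I CollectI)
          fix p assume p: "p \<in> J"
          have "z n * cis (- fst p) = rcis (norm (z n)) (\<phi> n - fst p)"
            by (subst zn) (simp add: rcis_def cis_mult mult.assoc)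
          then show "Re (z n * cis (- fst p)) < norm (z n) * cos (pi / (2 * snd p))"
            using n[OF p] False by (simp add: Re_rcis)
        qed
        then show ?thesis using W by blast
      qed
      then show False using z[of n] by (simp add: julia_set_def)
    qed
  qed
  ultimately show ?thesis using hol by blast
qed

end
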